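(* Let $N\ge1$ be an integer. For every $x\in\mathbb{R}$, both $|C(x)-C_N(x)|$ and $|S(x)-S_N(x)|$ are $$\le 2c_N\,\frac{e^{-\pi N}}{\sqrt{2N+1}},$$ and, for every real $x$ with $|x|\le\sqrt{N+1/2}$, both $|C(x)-C_N(x)|$ and $|S(x)-S_N(x)|$ are $$\le\sqrt\pi\,\tilde c_N\,|x|\,\frac{e^{-\pi N}}{2N+1}.$$ Here $(c_N)_{N\ge1}$ and $(\tilde c_N)_{N\ge1}$ (given explicitly in the context) are decreasing sequences of positive numbers, with $c_N<0.83$ and $\tilde c_N<0.18$ for all $N\ge1$.
   Context: The Fresnel integrals are $C(x):=\int_0^x\cos(\frac12\pi t^2)\,dt$ and $S(x):=\int_0^x\sin(\frac12\pi t^2)\,dt$. For an integer $N\ge1$ put $A_N:=\sqrt{(N+1/2)\pi}$, $t_k:=\frac{(k-1/2)\pi}{\sqrt{(N+1/2)\pi}}$, $$a_N(s):=s\sum_{k=1}^N\frac{e^{-t_k^2}}{s^2+t_k^4},\qquad b_N(s):=\sum_{k=1}^N\frac{t_k^2e^{-t_k^2}}{s^2+t_k^4},$$ and define $$C_N(x):=\frac12\,\frac{\sinh(\sqrt\pi A_Nx)+\sin(\sqrt\pi A_Nx)}{\cos(\sqrt\pi A_Nx)+\cosh(\sqrt\pi A_Nx)}+\frac{\sqrt\pi\,x}{A_N}\left(a_N\left(\tfrac\pi2x^2\right)\sin\left(\tfrac\pi2x^2\right)-b_N\left(\tfrac\pi2x^2\right)\cos\left(\tfrac\pi2x^2\right)\right),$$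 $$S_N(x):=\frac12\,\frac{\sinh(\sqrt\pi A_Nx)-\sin(\sqrt\pi A_Nx)}{\cos(\sqrt\pi A_Nx)+\cosh(\sqrt\pi A_Nx)}-\frac{\sqrt\pi\,x}{A_N}\left(a_N\left(\tfrac\pi2x^2\right)\cos\left(\tfrac\pi2x^2\right)+b_N\left(\tfrac\pi2x^2\right)\sin\left(\tfrac\pi2x^2\right)\right).$$ The constants are, with $\beta:=1-\frac{\sqrt2}{2}-\frac{2\sqrt2+1}{16}$, $$c_N:=\frac{20\sqrt2\,e^{-\pi/2}}{9\pi(1-e^{-2A_N^2})}\left(1+2\sqrt\pi\,e^{-\beta A_N^2}\right)+\frac{(2\pi+1)e^{-\pi/2}}{2\sqrt2\,\pi^{3/2}A_N},$$ $$\tilde c_N:=\frac{8}{3\pi^{3/2}e^{\pi/2}(1-e^{-2A_N^2})}+\frac{2\pi+1}{\pi^2e^{\pi/2}A_N}.$$ *)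

theory Defs
  imports "HOL-Analysis.Analysis"
begin

text \<open>The interval integral is oriented, so these are the intended odd functions for negative \<open>x\<close>.\<close>

definition fresnel_C :: "real \<Rightarrow> real" where
  "fresnel_C x = (LBINT t=0..x. cos (pi * t\<^sup>2 / 2))"

definition fresnel_S :: "real \<Rightarrow> real" where
  "fresnel_S x = (LBINT t=0..x. sin (pi * t\<^sup>2 / 2))"

definition A_rt :: "nat \<Rightarrow> real" where
  "A_rt N = sqrt ((real N + 1/2) * pi)"

definition t_node :: "nat \<Rightarrow> nat \<Rightarrow> real" where
  "t_node N k = (real k - 1/2) * pi / sqrt ((real N + 1/2) * pi)"

definition a_sum :: "nat \<Rightarrow> real \<Rightarrow> real" where
  "a_sum N s = s * (\<Sum>k=1..N. exp (- (t_node N k)\<^sup>2) / (s\<^sup>2 + t_node N k ^ 4))"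

definition b_sum :: "nat \<Rightarrow> real \<Rightarrow> real" where
  "b_sum N s = (\<Sum>k=1..N. (t_node N k)\<^sup>2 * exp (- (t_node N k)\<^sup>2) / (s\<^sup>2 + t_node N k ^ 4))"

definition C_approx :: "nat \<Rightarrow> real \<Rightarrow> real" where
  "C_approx N x =
     1/2 * ((sinh (sqrt pi * A_rt N * x) + sin (sqrt pi * A_rt N * x))
          / (cos (sqrt pi * A_rt N * x) + cosh (sqrt pi * A_rt N * x)))
   + sqrt pi * x / A_rt N
     * (a_sum N (pi / 2 * x\<^sup>2) * sin (pi / 2 * x\<^sup>2) - b_sum N (pi / 2 * x\<^sup>2) * cos (pi / 2 * x\<^sup>2))"

definition S_approx :: "nat \<Rightarrow> real \<Rightarrow> real" where
  "S_approx N x =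
     1/2 * ((sinh (sqrt pi * A_rt N * x) - sin (sqrt pi * A_rt N * x))
          / (cos (sqrt pi * A_rt N * x) + cosh (sqrt pi * A_rt N * x)))
   - sqrt pi * x / A_rt N
     * (a_sum N (pi / 2 * x\<^sup>2) * cos (pi / 2 * x\<^sup>2) + b_sum N (pi / 2 * x\<^sup>2) * sin (pi / 2 * x\<^sup>2))"

definition beta_val :: real where
  "beta_val = 1 - sqrt 2 / 2 - (2 * sqrt 2 + 1) / 16"

definition c_bd :: "nat \<Rightarrow> real" where
  "c_bd N =
     20 * sqrt 2 * exp (- pi / 2) / (9 * pi * (1 - exp (- 2 * (A_rt N)\<^sup>2)))
       * (1 + 2 * sqrt pi * exp (- beta_val * (A_rt N)\<^sup>2))
   + (2 * pi + 1) * exp (- pi / 2) / (2 * sqrt 2 * pi powr (3/2) * A_rt N)"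

definition c_tilde_bd :: "nat \<Rightarrow> real" where
  "c_tilde_bd N =
     8 / (3 * pi powr (3/2) * exp (pi / 2) * (1 - exp (- 2 * (A_rt N)\<^sup>2)))
   + (2 * pi + 1) / (pi\<^sup>2 * exp (pi / 2) * A_rt N)"

end

theory Submission
  imports Defs "HOL-Probability.Sinc_Integral" "HOL-Complex_Analysis.Residue_Theorem"
begin

text \<open>
  Put \<open>A = A_rt N\<close>, \<open>b = sqrt \<pi> x / 2\<close> and \<open>z = (1 + \<i>) b\<close>, so that \<open>z\<^sup>2 = \<i> \<pi> x\<^sup>2 / 2\<close>. Up to elementary factors
  the combination \<open>fresnel_C x + \<i> fresnel_S x\<close> is the integral of \<open>exp (- w\<^sup>2) 2 z / (w\<^sup>2 - z\<^sup>2)\<close> over a horizontal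
  line above \<open>z\<close>, and the approximant is the midpoint rule with step \<open>\<pi> / A\<close> for that integrand, corrected
  by the residue at the pole, which is the tangent term, and truncated after \<open>N\<close> nodes.

  Integrating the function times \<open>tan (A w)\<close> around a rectangle compares the two
  (\<open>midpoint_residue_theorem\<close>, \<open>midpoint_sum_tendsto\<close>). On the upper side the tangent is expanded as
  \<open>\<i> (1 + 2 \<Sum> (-1)\<^sup>n exp (2 \<i> n A w))\<close>, and \<open>1 / (w - z)\<close> is written as a Laplace integral in a new variable
  \<open>s\<close>; then the integral over the line is a Gaussian Fourier transform (\<open>gauss_cauchy_line\<close>,
  \<open>tan_line_integral\<close>). The result is an exact formula. Its term \<open>n = 0\<close> is the pair of Fresnel integrals
  (\<open>fresnel_alias_term_zero\<close>), and the terms \<open>n \<ge> 1\<close> are the aliasing error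

  \<open>exp (- (n A)\<^sup>2) (G (n A + \<i> z) - G (n A - \<i> z))\<close>, where
  \<open>G l = gauss_laplace l = \<integral> exp (- l s - s\<^sup>2 / 4) ds\<close> over \<open>s > 0\<close>.

  No contour remains in this formula, so nothing special happens when the pole
  is near the height \<open>A\<close>. The first estimate follows from \<open>norm (G l) \<le> 2 / norm l\<close> on the right half-plane,
  combined with the reflection formula for \<open>G\<close> when \<open>n A < b\<close> (\<open>alias_term_bound\<close>). For \<open>b \<le> A / 2\<close> the difference
  of the two transforms is bounded by the Laplace transform of a hyperbolic sine, which gives the factor
  \<open>\<bar>x\<bar>\<close> of the second estimate (\<open>alias_term_bound_small\<close>). The discarded nodes start at \<open>A\<close> itself and add an error of the same
  exponential order \<open>exp (- A\<^sup>2) = exp (- \<pi> / 2) exp (- \<pi> N)\<close> (\<open>node_tail_bound\<close>).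
\<close>

section \<open>Half-line Gaussian integrals\<close>

lemma integrable_exp_neg_square: "integrable lborel (\<lambda>x::real. exp (- x\<^sup>2))"
  using has_bochner_integral_even_function[OF gaussian_moment_0]
  by (simp add: has_bochner_integral_iff)

text \<open>The vertical part of the shift only multiplies the modulus by the constant \<open>exp ((Im a)\<^sup>2)\<close>.\<close>

lemma integrable_gauss_shift:
  fixes a :: complex
  shows "integrable lborel (\<lambda>s::real. exp (- ((of_real s / 2 + a)\<^sup>2)))"
proof (rule Bochner_Integration.integrable_bound)
  show "integrable lborel (\<lambda>s::real. exp ((Im a)\<^sup>2) * exp (- ((Re a + 1/2 * s)\<^sup>2)))"
    by (rule integrable_mult_right, rule lborel_integrable_real_affine[OF integrable_exp_neg_square]) auto
  show "(\<lambda>s::real. exp (- ((of_real s / 2 + a)\<^sup>2))) \<in> borel_measurable lborel"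
    by (auto intro!: borel_measurable_continuous_onI continuous_intros)
  show "AE s in lborel. norm (exp (- ((of_real s / 2 + a)\<^sup>2)))
          \<le> norm (exp ((Im a)\<^sup>2) * exp (- ((Re a + 1/2 * s)\<^sup>2)))"
    by (auto simp: norm_exp_eq_Re power2_eq_square algebra_simps simp flip: exp_add)
qed

lemma gauss_complete_square:
  fixes l :: complex
  shows "exp (- l * s - s\<^sup>2 / 4) = exp (l\<^sup>2) * exp (- ((s / 2 + l)\<^sup>2))"
  by (simp add: power2_eq_square algebra_simps flip: exp_add)

definition gauss_laplace :: "complex \<Rightarrow> complex" where
  "gauss_laplace l = (LBINT s:{0<..}. exp (- l * of_real s - (of_real s)\<^sup>2 / 4))"

lemma integrable_gauss_linear:
  fixes l :: complex
  shows "integrable lborel (\<lambda>s::real. exp (- l * of_real s - (of_real s)\<^sup>2 / 4))"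
  unfolding gauss_complete_square
  by (intro integrable_mult_right integrable_gauss_shift)

lemma set_integrable_gauss_linear:
  fixes l :: complex
  assumes "S \<in> sets borel"
  shows "set_integrable lborel S (\<lambda>s::real. exp (- l * of_real s - (of_real s)\<^sup>2 / 4))"
  unfolding set_integrable_def using assms
  by (intro integrable_mult_indicator integrable_gauss_linear) auto

lemma set_integrable_gauss_shift:
  fixes a :: complex
  assumes "S \<in> sets borel"
  shows "set_integrable lborel S (\<lambda>s::real. exp (- ((of_real s / 2 + a)\<^sup>2)))"
  unfolding set_integrable_def using assms
  by (intro integrable_mult_indicator integrable_gauss_shift) auto

text \<open>\<open>E\<close> is a multiple of the error function. Only its derivative and its oddness matter below, so
  it is obtained from Cauchy's theorem on the plane and symmetrised.\<close>

lemma gauss_primitive_exists: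
  obtains E :: "complex \<Rightarrow> complex"
  where "\<And>w. (E has_field_derivative exp (- (w\<^sup>2))) (at w)" "\<And>w. E (- w) = - E w"
proof -
  have "(\<lambda>w::complex. exp (- (w\<^sup>2))) holomorphic_on UNIV"
    by (intro holomorphic_intros)
  then obtain F :: "complex \<Rightarrow> complex" where F: "\<And>w. (F has_field_derivative exp (- (w\<^sup>2))) (at w)"
    using holomorphic_convex_primitive'[of UNIV "\<lambda>w::complex. exp (- (w\<^sup>2))"] by auto
  define E where "E w = (F w - F (- w)) / 2" for w
  show ?thesis
  proof
    show "(E has_field_derivative exp (- (w\<^sup>2))) (at w)" for w
    proof -
      have "((\<lambda>w. F (- w)) has_field_derivative exp (- ((- w)\<^sup>2)) * (- 1)) (at w)"
        by (rule DERIV_chain2[where f = F, OF F]) (rule DERIV_minus[OF DERIV_ident])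
      from DERIV_cdivide[OF DERIV_diff[OF F[of w] this], of 2]
      have "((\<lambda>w. (F w - F (- w)) / 2) has_field_derivative exp (- (w\<^sup>2))) (at w)"
        by simp
      thus ?thesis
        unfolding E_def[abs_def] .
    qed
    show "E (- w) = - E w" for w
      by (simp add: E_def diff_divide_distrib)
  qed
qed

text \<open>All horizontal rays lead to the same limit of the primitive, because \<open>exp (- w\<^sup>2)\<close> is tiny on
  any disc of fixed radius around a large positive point.\<close>

lemma gauss_primitive_shift_tendsto:
  fixes E :: "complex \<Rightarrow> complex"
  assumes E: "\<And>w. (E has_field_derivative exp (- (w\<^sup>2))) (at w)"
  shows "((\<lambda>s::real. E (of_real s / 2 + a) - E (of_real s / 2 + b)) \<longlongrightarrow> 0) at_top"
proof -
  define r where "r = max (norm a) (norm b)"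
  have r: "norm a \<le> r" "norm b \<le> r" "r \<ge> 0"
    by (auto simp: r_def le_max_iff_disj)
  have bd: "norm (E (of_real s / 2 + a) - E (of_real s / 2 + b)) \<le> exp (r\<^sup>2 - (s / 2 - r)\<^sup>2) * norm (a - b)"
    if s: "s \<ge> 2 * r" for s :: real
  proof -
    have "norm (E (of_real s / 2 + a) - E (of_real s / 2 + b))
        \<le> exp (r\<^sup>2 - (s / 2 - r)\<^sup>2) * norm ((of_real s / 2 + a) - (of_real s / 2 + b))"
    proof (rule field_differentiable_bound[where S = "cball (of_real s / 2) r"])
      show "(E has_field_derivative exp (- (w\<^sup>2))) (at w within cball (of_real s / 2) r)" for w
        using E has_field_derivative_at_within by blast
      show "norm (exp (- (w\<^sup>2))) \<le> exp (r\<^sup>2 - (s / 2 - r)\<^sup>2)" if w: "w \<in> cball (of_real s / 2) r" for w :: complex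
      proof -
        have n: "norm (w - of_real s / 2) \<le> r"
          using w by (simp add: dist_norm norm_minus_commute)
        have im: "\<bar>Im w\<bar> \<le> r" using abs_Im_le_cmod[of "w - of_real s / 2"] n by simp
        have "\<bar>Re w - s/2\<bar> \<le> r" using abs_Re_le_cmod[of "w - of_real s / 2"] n by simp
        hence re: "Re w \<ge> s / 2 - r" by linarith
        have "(Re w)\<^sup>2 \<ge> (s/2 - r)\<^sup>2" using re s by (intro power_mono) auto
        moreover have "(Im w)\<^sup>2 \<le> r\<^sup>2" using im r by (metis abs_le_square_iff abs_of_nonneg)
        ultimately show ?thesis
          by (auto simp: norm_exp_eq_Re power2_eq_square)
      qed
    qed (use r in \<open>auto simp: dist_norm\<close>)
    thus ?thesis by simp
  qed
  have "((\<lambda>s::real. exp (r\<^sup>2 - (s / 2 - r)\<^sup>2) * norm (a - b)) \<longlongrightarrow> 0 * norm (a - b)) at_top"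
  proof (intro tendsto_mult tendsto_const)
    show "((\<lambda>s::real. exp (r\<^sup>2 - (s / 2 - r)\<^sup>2)) \<longlongrightarrow> 0) at_top"
    proof (rule filterlim_compose[OF exp_at_bot])
      have *: "r\<^sup>2 - (s / 2 - r)\<^sup>2 = - ((s/4 - r) * s)" for s :: real
        by (simp add: power2_eq_square field_simps)
      have "filterlim (\<lambda>s::real. s/4 - r) at_top at_top"
        unfolding diff_conv_add_uminus
        by (intro filterlim_tendsto_add_at_top[of "\<lambda>_. -r", simplified add.commute[of "-r"]] tendsto_const
             filterlim_tendsto_pos_mult_at_top[of "\<lambda>_. 1/4" "1/4", simplified] filterlim_ident) auto
      thus "filterlim (\<lambda>s::real. r\<^sup>2 - (s / 2 - r)\<^sup>2) at_bot at_top"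
        unfolding * filterlim_uminus_at_top[symmetric]
        by (intro filterlim_at_top_mult_at_top filterlim_ident)
    qed
  qed
  hence "((\<lambda>s::real. exp (r\<^sup>2 - (s / 2 - r)\<^sup>2) * norm (a - b)) \<longlongrightarrow> 0) at_top" by simp
  thus ?thesis
    by (rule Lim_null_comparison[rotated]) (use bd in \<open>auto simp: eventually_at_top_linorder\<close>)
qed

text \<open>The contributions at infinity cancel by the preceding lemma; hence differences of such
  integrals need no value of the Gaussian integral.\<close>

lemma half_line_gauss_difference:
  fixes E :: "complex \<Rightarrow> complex"
  assumes E: "\<And>w. (E has_field_derivative exp (- (w\<^sup>2))) (at w)"
  shows "(LBINT s:{0<..}. exp (- ((of_real s / 2 + a)\<^sup>2))) - (LBINT s:{0<..}. exp (- ((of_real s / 2 + b)\<^sup>2)))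
         = 2 * (E b - E a)"
proof -
  let ?f = "\<lambda>s::real. exp (- ((of_real s / 2 + a)\<^sup>2)) - exp (- ((of_real s / 2 + b)\<^sup>2))"
  let ?F = "\<lambda>s::real. 2 * (E (of_real s / 2 + a) - E (of_real s / 2 + b))"
  have dE: "((\<lambda>s::real. E (of_real s / 2 + c)) has_vector_derivative exp (- ((of_real s / 2 + c)\<^sup>2)) / 2) (at s)"
    for s c
  proof -
    have "((\<lambda>w. E (w / 2 + c)) has_field_derivative exp (- ((of_real s / 2 + c)\<^sup>2)) / 2) (at (of_real s))"
      by (rule DERIV_cong[OF DERIV_chain2[where f = E, OF E]]) (auto intro!: derivative_eq_intros)
    thus ?thesis by (rule has_vector_derivative_real_field)
  qed
  have dF: "(?F has_vector_derivative ?f s) (at s)" for s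
    using has_vector_derivative_mult_right[OF has_vector_derivative_diff[OF dE[of a s] dE[of b s]], of 2]
    by (simp add: diff_divide_distrib)
  have int: "set_integrable lborel {0<..} ?f"
    by (intro set_integral_diff set_integrable_gauss_shift) auto
  have "(LBINT s=0..\<infinity>. ?f s) = 0 - 2 * (E a - E b)"
  proof (rule interval_integral_FTC_integrable[where F = ?F])
    show "set_integrable lborel (einterval 0 \<infinity>) ?f"
      using int by (simp add: einterval_def zero_ereal_def greaterThan_def)
    have "continuous (at 0) ?F"
      using dF[of 0] by (rule has_vector_derivative_continuous)
    hence "(?F \<longlongrightarrow> ?F 0) (at 0)" by (simp add: isCont_def)
    hence "(?F \<longlongrightarrow> 2 * (E a - E b)) (at_right 0)"
      by (simp add: filterlim_at_split)
    thus "((?F \<circ> real_of_ereal) \<longlongrightarrow> 2 * (E a - E b)) (at_right 0)"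
      by (simp add: zero_ereal_def ereal_tendsto_simps)
    have "(?F \<longlongrightarrow> 2 * 0) at_top"
      by (intro tendsto_mult tendsto_const gauss_primitive_shift_tendsto E)
    thus "((?F \<circ> real_of_ereal) \<longlongrightarrow> 0) (at_left \<infinity>)"
      by (simp add: ereal_tendsto_simps)
    show "(?F has_vector_derivative ?f s) (at s)" for s
      by (rule dF)
    show "isCont ?f s" for s
      by (intro continuous_intros) simp_all
  qed simp
  also have "(LBINT s=0..\<infinity>. ?f s) = (LBINT s:{0<..}. ?f s)"
    by (simp add: interval_integral_to_infinity_eq zero_ereal_def)
  also have "\<dots> = (LBINT s:{0<..}. exp (- ((of_real s / 2 + a)\<^sup>2))) - (LBINT s:{0<..}. exp (- ((of_real s / 2 + b)\<^sup>2)))"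
    by (intro set_integral_diff set_integrable_gauss_shift) auto
  finally show ?thesis by (simp add: algebra_simps)
qed

lemma gauss_laplace_eq:
  "gauss_laplace l = exp (l\<^sup>2) * (LBINT s:{0<..}. exp (- ((of_real s / 2 + l)\<^sup>2)))"
  unfolding gauss_laplace_def gauss_complete_square by simp

lemma integral_half_gauss:
  "(LBINT s:{0<..}. exp (- ((of_real s / 2 :: complex)\<^sup>2))) = of_real (sqrt pi)"
proof -
  have "(LBINT s:{0<..}. exp (- ((of_real s / 2 :: complex)\<^sup>2)))
      = (LBINT s:{0<..}. complex_of_real (exp (- ((s / 2 :: real)\<^sup>2))))"
    by (simp add: exp_of_real [symmetric])
  also have "\<dots> = of_real (LBINT s:{0<..}. exp (- ((s / 2 :: real)\<^sup>2)))"
    by (rule set_integral_complex_of_real)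
  also have "(LBINT s:{0<..}. exp (- ((s / 2 :: real)\<^sup>2))) = (\<integral>s. indicator {0..} s *\<^sub>R exp (- ((s/2::real)\<^sup>2)) \<partial>lborel)"
    unfolding set_lebesgue_integral_def
    by (rule integral_cong_AE)
       (measurable, auto intro!: AE_I[where N="{0::real}"] split: split_indicator_asm split_indicator)
  also have "\<dots> = 2 * (\<integral>s. indicator {0..} s *\<^sub>R exp (- s\<^sup>2) \<partial>lborel)"
  proof -
    have "(\<integral>s. indicator {0..} s *\<^sub>R exp (- s\<^sup>2) \<partial>lborel)
        = 1/2 * (\<integral>s. indicator {0..} (s/2) *\<^sub>R exp (- ((s/2::real)\<^sup>2)) \<partial>lborel)"
      using lborel_integral_real_affine[of "1/2" "\<lambda>s::real. indicator {0..} s *\<^sub>R exp (- s\<^sup>2)" 0] by simp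
    moreover have "indicator {0..} (s/2) = (indicator {0..} s :: real)" for s :: real
      by (simp add: indicator_def)
    ultimately show ?thesis by simp
  qed
  also have "\<dots> = sqrt pi"
    using gaussian_moment_0 by (simp add: has_bochner_integral_iff)
  finally show ?thesis .
qed

text \<open>This is the Gaussian integral over the whole line with a complex linear term. It converts a
  transform at an argument with negative real part, where no decaying bound is available, into one
  at an argument with positive real part plus an explicit exponential.\<close>

lemma gauss_laplace_reflection:
  fixes l :: complex
  shows "gauss_laplace l + gauss_laplace (- l) = 2 * sqrt pi * exp (l\<^sup>2)"
proof -
  obtain E :: "complex \<Rightarrow> complex" where E: "\<And>w. (E has_field_derivative exp (- (w\<^sup>2))) (at w)" "\<And>w. E (- w) = - E w"
    using gauss_primitive_exists by blast
  let ?I = "\<lambda>l::complex. LBINT s:{0<..}. exp (- ((of_real s / 2 + l)\<^sup>2))"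
  have "?I l + ?I (- l) = 2 * sqrt pi"
    using half_line_gauss_difference[OF E(1), of l 0] half_line_gauss_difference[OF E(1), of "-l" 0] E(2)[of 0]
    by (simp add: integral_half_gauss E(2) algebra_simps)
  hence "exp (l\<^sup>2) * (?I l + ?I (- l)) = exp (l\<^sup>2) * (2 * sqrt pi)" by (simp only:)
  thus ?thesis
    unfolding gauss_laplace_eq by (simp add: algebra_simps)
qed

section \<open>Cauchy integrals of a Gaussian along a horizontal line\<close>

text \<open>On the line \<open>Im w = H\<close> the contribution of \<open>H\<close> factors out of the integrand, so the Fourier
  transform of the Gaussian does not depend on the height of the line.\<close>

lemma gauss_line_integral:
  fixes H u :: real
  shows "integrable lborel (\<lambda>t. exp (- ((Complex t H)\<^sup>2) + \<i> * of_real u * Complex t H))"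
    and "(LBINT t. exp (- ((Complex t H)\<^sup>2) + \<i> * of_real u * Complex t H)) = of_real (sqrt pi * exp (- (u\<^sup>2) / 4))"
proof -
  have gi: "integrable lborel (\<lambda>s::real. exp (- l * of_real s - (of_real s)\<^sup>2 / 4))" for l :: complex
    by (rule integrable_gauss_linear)
  have split: "(LBINT s. exp (- l * of_real s - (of_real s)\<^sup>2 / 4)) = gauss_laplace l + gauss_laplace (- l)" for l :: complex
  proof -
    let ?g = "\<lambda>s::real. exp (- l * of_real s - (of_real s)\<^sup>2 / 4)"
    have "(LBINT s. ?g s) = (LBINT s:{0<..} \<union> {..<0}. ?g s)"
      unfolding set_lebesgue_integral_def
      by (intro integral_cong_AE) (measurable, auto intro!: AE_I[where N="{0::real}"] split: split_indicator_asm split_indicator)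
    also have "\<dots> = (LBINT s:{0<..}. ?g s) + (LBINT s:{..<0}. ?g s)"
      by (intro set_integral_Un set_integrable_gauss_linear) auto
    also have "(LBINT s:{..<0}. ?g s) = (LBINT s. indicator {..<0} (0 + (- 1) * s) *\<^sub>R ?g (0 + (- 1) * s))"
      unfolding set_lebesgue_integral_def by (subst lborel_integral_real_affine[where c = "-1" and t = 0]) auto
    also have "\<dots> = gauss_laplace (- l)"
      unfolding gauss_laplace_def set_lebesgue_integral_def
      by (intro Bochner_Integration.integral_cong) (auto split: split_indicator)
    finally show ?thesis by (simp add: gauss_laplace_def)
  qed
  define l :: complex where "l = \<i> * of_real H - \<i> * of_real u / 2"
  have eq: "exp (- ((Complex t H)\<^sup>2) + \<i> * of_real u * Complex t H)
      = exp (of_real (H\<^sup>2 - u * H)) * exp (- l * of_real (2 * t) - (of_real (2 * t))\<^sup>2 / 4)" for t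
    unfolding exp_add[symmetric]
    by (rule arg_cong[where f = exp]) (simp add: l_def complex_eq_iff power2_eq_square algebra_simps)
  have "integrable lborel (\<lambda>t::real. exp (- l * of_real (0 + 2 * t) - (of_real (0 + 2 * t))\<^sup>2 / 4))"
    by (rule lborel_integrable_real_affine[OF gi]) simp
  thus "integrable lborel (\<lambda>t. exp (- ((Complex t H)\<^sup>2) + \<i> * of_real u * Complex t H))"
    unfolding eq by (intro integrable_mult_right) simp
  have "(LBINT t. exp (- l * of_real (2 * t) - (of_real (2 * t))\<^sup>2 / 4))
      = (LBINT s. exp (- l * of_real s - (of_real s)\<^sup>2 / 4)) / 2"
    using lborel_integral_real_affine[of 2 "\<lambda>s. exp (- l * of_real s - (of_real s)\<^sup>2 / 4)" 0]
    by (simp add: scaleR_conv_of_real)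
  also have "\<dots> = sqrt pi * exp (l\<^sup>2)"
    unfolding split gauss_laplace_reflection by simp
  finally have "(LBINT t. exp (- ((Complex t H)\<^sup>2) + \<i> * of_real u * Complex t H))
      = exp (of_real (H\<^sup>2 - u * H)) * (sqrt pi * exp (l\<^sup>2))"
    unfolding eq by simp
  also have "\<dots> = sqrt pi * exp (of_real (H\<^sup>2 - u * H) + l\<^sup>2)"
    by (simp add: exp_add)
  also have "of_real (H\<^sup>2 - u * H) + l\<^sup>2 = of_real (- (u\<^sup>2) / 4)"
    by (simp add: l_def complex_eq_iff power2_eq_square algebra_simps)
  finally show "(LBINT t. exp (- ((Complex t H)\<^sup>2) + \<i> * of_real u * Complex t H)) = of_real (sqrt pi * exp (- (u\<^sup>2) / 4))"
    by (simp only: exp_of_real of_real_mult)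
qed

lemma integral_exp_half_line:
  fixes c :: complex
  assumes c: "Re c < 0"
  shows "set_integrable lborel {0<..} (\<lambda>s. exp (c * of_real s))"
    and "(LBINT s:{0<..}. exp (c * of_real s)) = - (1 / c)"
    and "set_integrable lborel {0<..} (\<lambda>s. exp (Re c * s))"
    and "(LBINT s:{0<..}. exp (Re c * s)) = - (1 / Re c)"
proof -
  have ri: "set_integrable lborel {0<..} (\<lambda>s. exp (Re c * s))"
    using integrable_I0i_exp_mscale[of "- Re c"] c by (simp add: mult.commute)
  show "set_integrable lborel {0<..} (\<lambda>s. exp (Re c * s))" by (rule ri)
  show "(LBINT s:{0<..}. exp (Re c * s)) = - (1 / Re c)"
    using LBINT_I0i_exp_mscale[of "- Re c"] c
    by (simp add: interval_integral_to_infinity_eq zero_ereal_def mult.commute)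
  show ci: "set_integrable lborel {0<..} (\<lambda>s. exp (c * of_real s))"
    by (rule set_integrable_bound[OF ri]) (auto simp: norm_exp_eq_Re set_borel_measurable_def)
  have "(LBINT s=0..\<infinity>. exp (c * of_real s)) = 0 - 1 / c"
  proof (rule interval_integral_FTC_integrable[where F = "\<lambda>s. exp (c * of_real s) / c"])
    show "((\<lambda>s::real. exp (c * of_real s) / c) has_vector_derivative exp (c * of_real s)) (at s)" for s
    proof -
      have "((\<lambda>w. exp (c * w) / c) has_field_derivative exp (c * of_real s)) (at (of_real s))"
        using c by (auto intro!: derivative_eq_intros)
      thus ?thesis by (rule has_vector_derivative_real_field)
    qed
    show "isCont (\<lambda>s::real. exp (c * of_real s)) s" for s
      by (intro continuous_intros)
    show "set_integrable lborel (einterval 0 \<infinity>) (\<lambda>s::real. exp (c * of_real s))"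
      using ci by (simp add: einterval_def zero_ereal_def greaterThan_def)
    have "isCont (\<lambda>s::real. exp (c * of_real s) / c) 0" using c by (intro continuous_intros) auto
    hence "((\<lambda>s::real. exp (c * of_real s) / c) \<longlongrightarrow> 1 / c) (at_right 0)"
      by (simp add: isCont_def filterlim_at_split)
    thus "(((\<lambda>s::real. exp (c * of_real s) / c) \<circ> real_of_ereal) \<longlongrightarrow> 1 / c) (at_right 0)"
      by (simp add: zero_ereal_def ereal_tendsto_simps)
    have "((\<lambda>s::real. norm (exp (c * of_real s))) \<longlongrightarrow> 0) at_top"
    proof -
      have "filterlim (\<lambda>s. Re c * s) at_bot at_top"
        using c by (intro filterlim_tendsto_neg_mult_at_bot[OF tendsto_const] filterlim_ident) auto
      thus ?thesis by (simp add: norm_exp_eq_Re filterlim_compose[OF exp_at_bot])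
    qed
    hence "((\<lambda>s::real. exp (c * of_real s)) \<longlongrightarrow> 0) at_top" by (rule tendsto_norm_zero_cancel)
    hence "((\<lambda>s::real. exp (c * of_real s) / c) \<longlongrightarrow> 0 / c) at_top" 
      using c by (intro tendsto_divide tendsto_const) auto
    thus "(((\<lambda>s::real. exp (c * of_real s) / c) \<circ> real_of_ereal) \<longlongrightarrow> 0) (at_left \<infinity>)"
      by (simp add: ereal_tendsto_simps)
  qed auto
  thus "(LBINT s:{0<..}. exp (c * of_real s)) = - (1 / c)"
    by (simp add: interval_integral_to_infinity_eq zero_ereal_def)
qed

text \<open>Above the pole, \<open>1 / (w - z) = - \<i> * \<integral> exp (\<i> (w - z) s) ds\<close> over \<open>s > 0\<close>; exchanging the
  integrals leaves the Fourier transform of the Gaussian in \<open>w\<close>. The result is independent of how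
  close the line passes to the pole, which is what keeps the final error bounds uniform in the
  argument.\<close>

lemma gauss_cauchy_line:
  fixes H u :: real and z :: complex
  assumes H: "Im z < H" and u: "u \<ge> 0"
  shows "integrable lborel (\<lambda>t. exp (- ((Complex t H)\<^sup>2) + \<i> * of_real (2 * u) * Complex t H) / (Complex t H - z))"
    and "(LBINT t. exp (- ((Complex t H)\<^sup>2) + \<i> * of_real (2 * u) * Complex t H) / (Complex t H - z))
       = - \<i> * sqrt pi * exp (- (u\<^sup>2)) * gauss_laplace (of_real u + \<i> * z)"
proof -
  let ?G = "\<lambda>t. exp (- ((Complex t H)\<^sup>2) + \<i> * of_real (2 * u) * Complex t H)"
  let ?f = "\<lambda>t s. indicator {0<..} s *\<^sub>R (?G t * exp (\<i> * (Complex t H - z) * of_real s))"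
  have Gi: "integrable lborel ?G"
    by (rule gauss_line_integral)
  have inner: "(LBINT s. ?f t s) = \<i> * (?G t / (Complex t H - z))"
       and inner_int: "integrable lborel (?f t)"
       and inner_norm: "(LBINT s. norm (?f t s)) = norm (?G t) * (1 / (H - Im z))" for t
  proof -
    have ne: "Complex t H - z \<noteq> 0" using H by (auto simp: complex_eq_iff)
    have lt: "Re (\<i> * (Complex t H - z)) < 0" using H by simp
    show "(LBINT s. ?f t s) = \<i> * (?G t / (Complex t H - z))"
    proof -
      have "(LBINT s. ?f t s) = (LBINT s. ?G t * (indicator {0<..} s *\<^sub>R exp (\<i> * (Complex t H - z) * of_real s)))"
        by (simp only: mult_scaleR_right)
      also have "\<dots> = ?G t * (- (1 / (\<i> * (Complex t H - z))))"
        using integral_exp_half_line(2)[OF lt]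
        by (simp only: integral_mult_right_zero set_lebesgue_integral_def)
      also have "\<dots> = \<i> * (?G t / (Complex t H - z))"
        using ne by (simp add: divide_simps)
      finally show ?thesis .
    qed
    show "integrable lborel (?f t)"
      using integral_exp_half_line(1)[OF lt]
      by (simp add: set_integrable_def flip: mult_scaleR_right)
    have "(LBINT s. norm (?f t s)) = (LBINT s. norm (?G t) * (indicator {0<..} s *\<^sub>R exp (Re (\<i> * (Complex t H - z)) * s)))"
      by (intro Bochner_Integration.integral_cong) (auto simp: norm_mult norm_exp_eq_Re split: split_indicator)
    also have "\<dots> = norm (?G t) * (1 / (H - Im z))"
      using integral_exp_half_line(4)[OF lt]
      by (simp add: set_lebesgue_integral_def minus_divide_right)
    finally show "(LBINT s. norm (?f t s)) = norm (?G t) * (1 / (H - Im z))" .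
  qed
  have meas: "(\<lambda>(t, s). ?f t s) \<in> borel_measurable (lborel \<Otimes>\<^sub>M lborel)"
    unfolding Complex_eq by measurable
  \<comment> \<open>The modulus factorises up to a constant, with decay in \<open>s\<close> because the line lies above the pole.\<close>
  have int2: "integrable (lborel \<Otimes>\<^sub>M lborel) (\<lambda>(t, s). ?f t s)"
  proof (rule lborel_pair.Fubini_integrable[OF meas])
    show "integrable lborel (\<lambda>x. LBINT y. norm (case (x, y) of (t, s) \<Rightarrow> ?f t s))"
      using Gi by (simp only: prod.case inner_norm) (intro integrable_mult_left integrable_norm)
    show "AE x in lborel. integrable lborel (\<lambda>y. case (x, y) of (t, s) \<Rightarrow> ?f t s)"
      using inner_int by simp
  qed
  have "integrable lborel (\<lambda>t. LBINT s. ?f t s)"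
    using lborel_pair.integrable_fst'[OF int2] by simp
  hence i1: "integrable lborel (\<lambda>t. \<i> * (?G t / (Complex t H - z)))"
    unfolding inner .
  thus "integrable lborel (\<lambda>t. ?G t / (Complex t H - z))"
    using integrable_mult_right[OF i1, of "- \<i>"] by (simp flip: mult.assoc)
  have "(LBINT t. \<i> * (?G t / (Complex t H - z))) = (LBINT t. LBINT s. ?f t s)"
    unfolding inner ..
  also have "\<dots> = (LBINT s. LBINT t. ?f t s)"
    by (rule lborel_pair.Fubini_integral[OF int2, symmetric])
  also have "\<dots> = (LBINT s. of_real (sqrt pi) * exp (- (of_real u)\<^sup>2) * (indicator {0<..} s *\<^sub>R exp (- (of_real u + \<i> * z) * of_real s - (of_real s)\<^sup>2 / 4)))"
  proof (intro Bochner_Integration.integral_cong refl)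
    fix s :: real
    have "(LBINT t. ?f t s) = (LBINT t. (indicator {0<..} s *\<^sub>R exp (- \<i> * z * of_real s))
             * exp (- ((Complex t H)\<^sup>2) + \<i> * of_real (2 * u + s) * Complex t H))"
      by (intro Bochner_Integration.integral_cong refl) (simp add: algebra_simps exp_add exp_diff exp_minus divide_inverse)
    also have "\<dots> = (indicator {0<..} s *\<^sub>R exp (- \<i> * z * of_real s)) * of_real (sqrt pi * exp (- ((2 * u + s)\<^sup>2) / 4))"
      by (simp only: integral_mult_right_zero gauss_line_integral)
    also have "complex_of_real (exp (- ((2 * u + s)\<^sup>2) / 4)) = exp (- (of_real u)\<^sup>2) * exp (- of_real u * of_real s - (of_real s)\<^sup>2 / 4)"
      unfolding exp_of_real[symmetric] exp_add[symmetric]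
      by (rule arg_cong[where f = exp]) (simp add: power2_eq_square field_simps)
    hence "(indicator {0<..} s *\<^sub>R exp (- \<i> * z * of_real s)) * of_real (sqrt pi * exp (- ((2 * u + s)\<^sup>2) / 4))
       = of_real (sqrt pi) * exp (- (of_real u)\<^sup>2) * (indicator {0<..} s *\<^sub>R (exp (- \<i> * z * of_real s) * exp (- of_real u * of_real s - (of_real s)\<^sup>2 / 4)))"
      by (simp add: split: split_indicator)
    also have "exp (- \<i> * z * of_real s) * exp (- of_real u * of_real s - (of_real s)\<^sup>2 / 4)
       = exp (- (of_real u + \<i> * z) * of_real s - (of_real s)\<^sup>2 / 4)"
      by (simp add: algebra_simps flip: exp_add)
    finally show "(LBINT t. ?f t s) = of_real (sqrt pi) * exp (- (of_real u)\<^sup>2) * (indicator {0<..} s *\<^sub>R exp (- (of_real u + \<i> * z) * of_real s - (of_real s)\<^sup>2 / 4))" .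
  qed
  also have "\<dots> = of_real (sqrt pi) * exp (- (of_real u)\<^sup>2) * gauss_laplace (of_real u + \<i> * z)"
    unfolding gauss_laplace_def set_lebesgue_integral_def by (rule integral_mult_right_zero)
  finally have *: "\<i> * (LBINT t. ?G t / (Complex t H - z)) = of_real (sqrt pi) * exp (- (of_real u)\<^sup>2) * gauss_laplace (of_real u + \<i> * z)"
    by (simp only: integral_mult_right_zero)
  have "(LBINT t. ?G t / (Complex t H - z)) = - \<i> * (\<i> * (LBINT t. ?G t / (Complex t H - z)))"
    by (simp flip: mult.assoc)
  thus "(LBINT t. ?G t / (Complex t H - z)) = - \<i> * sqrt pi * exp (- (u\<^sup>2)) * gauss_laplace (of_real u + \<i> * z)"
    unfolding * by (simp add: exp_of_real[symmetric])
qed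

section \<open>The midpoint rule by residues\<close>

text \<open>The tangent has its poles exactly at the nodes of the midpoint rule and their mirror images,
  with equal residues, and \<open>2 z / (w\<^sup>2 - z\<^sup>2)\<close> adds the poles at \<open>z\<close> and \<open>- z\<close>. The vertical
  sides lie half-way between neighbouring nodes.\<close>

lemma midpoint_residue_theorem:
  fixes A H :: real and z :: complex and M :: nat
  assumes A: "A > 0" and z: "0 < Im z" "Im z < H" and R: "\<bar>Re z\<bar> < real M * pi / A"
  defines "\<phi> \<equiv> \<lambda>w. exp (- (w\<^sup>2)) * (2 * z / (w\<^sup>2 - z\<^sup>2)) * tan (of_real A * w)"
    and "t \<equiv> \<lambda>k::nat. (real k - 1/2) * pi / A"
    and "R \<equiv> real M * pi / A"
  shows "contour_integral (rectpath (Complex (-R) (-H)) (Complex R H)) \<phi>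
       = 2 * pi * \<i> * (2 * exp (- (z\<^sup>2)) * tan (of_real A * z)
            - 2 / A * (\<Sum>k=1..M. exp (- (of_real (t k))\<^sup>2) * (2 * z / ((of_real (t k))\<^sup>2 - z\<^sup>2))))"
    and "continuous_on (path_image (rectpath (Complex (-R) (-H)) (Complex R H))) \<phi>"
proof -
  \<comment> \<open>As a quotient of entire functions, the integrand has the same residue formula at all its poles.\<close>
  define P where "P = (\<lambda>w. exp (- (w\<^sup>2)) * (2 * z) * sin (of_real A * w))"
  define Q where "Q = (\<lambda>w. (w\<^sup>2 - z\<^sup>2) * cos (of_real A * w))"
  define Q' where "Q' = (\<lambda>w. 2 * w * cos (of_real A * w) - of_real A * (w\<^sup>2 - z\<^sup>2) * sin (of_real A * w))"
  define tc where "tc = (\<lambda>k. complex_of_real (t k))"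
  define pts where "pts = {z, - z} \<union> (tc ` {1..M} \<union> (\<lambda>k. - tc k) ` {1..M})"
  \<comment> \<open>The wider open box still contains no further node, since its sides pass through the next nodes.\<close>
  define S where "S = box (Complex (- R - pi / (2 * A)) (- H - 1)) (Complex (R + pi / (2 * A)) (H + 1))"
  have phi: "\<phi> = (\<lambda>w. P w / Q w)"
    by (simp add: \<phi>_def P_def Q_def tan_def fun_eq_iff)
  have H: "H > 0" using z by simp
  have z0: "z \<noteq> 0" using z by auto
  have R0: "R > 0" using R unfolding R_def by linarith
  have rp: "pi / (2 * A) > 0" using A by simp
  have sin_nz: "sin (of_real A * w) \<noteq> 0" if "cos (of_real A * w) = 0" for w :: complex
    using that sin_cos_squared_add[of "of_real A * w"] by auto
  have cos_z: "cos (of_real A * w) \<noteq> 0" if "Im w \<noteq> 0" for w :: complex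
  proof
    assume "cos (of_real A * w) = 0"
    then obtain n :: int where "of_real A * w = of_real (of_int n * pi) + of_real pi / 2"
      by (auto simp: cos_eq_0)
    hence "Im (of_real A * w) = Im (of_real (of_int n * pi) + of_real pi / 2)" by (simp only:)
    thus False using that A by simp
  qed
  have zeros: "w \<in> pts" if w: "w \<in> S" "Q w = 0" for w
  proof (cases "w\<^sup>2 = z\<^sup>2")
    case True
    thus ?thesis by (auto simp: pts_def power2_eq_iff)
  next
    case False
    hence "cos (of_real A * w) = 0" using w by (simp add: Q_def)
    then obtain n :: int where n: "of_real A * w = of_real (of_int n * pi) + of_real pi / 2"
      by (auto simp: cos_eq_0)
    hence "of_real A * w = of_real ((of_int n + 1/2) * pi)" by (simp add: algebra_simps)
    hence wn: "w = of_real ((of_int n + 1/2) * pi / A)" using A by (simp add: field_simps)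
    hence "\<bar>(of_int n + 1/2) * pi / A\<bar> < R + pi / (2 * A)"
      using w(1) by (auto simp: S_def in_box_complex_iff)
    also have "\<bar>(of_int n + 1/2) * pi / A\<bar> = \<bar>of_int n + 1/2\<bar> * (pi / A)"
      using A by (simp add: abs_mult)
    also have "R + pi / (2 * A) = (real M + 1/2) * (pi / A)"
      using A by (simp add: R_def field_simps)
    finally have "\<bar>of_int n + 1/2\<bar> * (pi / A) < (real M + 1/2) * (pi / A)" .
    moreover have "pi / A > 0" using A by simp
    ultimately have "\<bar>of_int n + 1/2\<bar> < real M + 1/2" by (simp only: mult_less_cancel_right_pos)
    hence n2: "of_int n < real M" "- real M - 1 < of_int n" by linarith+
    show ?thesis
    proof (cases "n \<ge> 0")
      case True
      have "w = tc (nat (n + 1))" using True by (simp add: wn tc_def t_def)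
      moreover have "nat (n + 1) \<in> {1..M}" using True n2 by auto
      ultimately show ?thesis unfolding pts_def by blast
    next
      case False
      have "real (nat (- n)) - 1/2 = - (of_int n + 1/2)" using False by simp
      hence "t (nat (- n)) = - ((of_int n + 1/2) * pi / A)" 
        unfolding t_def by (simp only: mult_minus_left minus_divide_left)
      hence "w = - tc (nat (- n))" by (simp add: wn tc_def)
      moreover have "nat (- n) \<in> {1..M}" using False n2 by auto
      ultimately show ?thesis unfolding pts_def by blast
    qed
  qed
  have tk: "0 < t k" "t k < R" if "k \<in> {1..M}" for k
  proof -
    show "0 < t k" using that A by (simp add: t_def)
    show "t k < R" unfolding t_def R_def
      using that A by (intro divide_strict_right_mono mult_strict_right_mono) auto
  qed
  have costc: "cos (of_real A * tc k) = 0" for k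
  proof -
    have "of_real A * tc k = of_real (real k * pi - pi / 2)"
      using A by (simp add: tc_def t_def field_simps)
    hence "cos (of_real A * tc k) = of_real (cos (real k * pi - pi / 2))"
      by (simp only: cos_of_real)
    also have "cos (real k * pi - pi / 2) = 0" by (simp add: cos_diff)
    finally show ?thesis by simp
  qed
  have inbox: "pts \<subseteq> box (Complex (-R) (-H)) (Complex R H)"
    using z R tk R0 H by (auto simp: pts_def in_box_complex_iff tc_def R_def abs_less_iff) (fastforce dest: tk)+
  have box_sub: "cbox (Complex (-R) (-H)) (Complex R H) \<subseteq> S"
    using rp by (auto simp: S_def in_box_complex_iff in_cbox_complex_iff)
  have pts_sub: "pts \<subseteq> S" using inbox box_sub box_subset_cbox by blast
  have Pholo: "P holomorphic_on S" and Qholo: "Q holomorphic_on S"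
    unfolding P_def Q_def by (intro holomorphic_intros)+
  have phiholo: "\<phi> holomorphic_on S - pts"
    unfolding phi
    by (intro holomorphic_on_divide holomorphic_on_subset[OF Pholo] holomorphic_on_subset[OF Qholo])
       (use zeros in auto)
  have pimg: "path_image (rectpath (Complex (-R) (-H)) (Complex R H)) \<subseteq> S - pts"
    using inbox box_sub R0 H by (subst path_image_rectpath_cbox_minus_box) auto
  show "continuous_on (path_image (rectpath (Complex (-R) (-H)) (Complex R H))) \<phi>"
    using phiholo pimg by (meson continuous_on_subset holomorphic_on_imp_continuous_on)
  have Qder: "(Q has_field_derivative Q' w) (at w)" for w
    unfolding Q_def Q'_def by (auto intro!: derivative_eq_intros simp: algebra_simps)
  have Pz: "P p \<noteq> 0" if "p \<in> pts" for p
  proof -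
    have "sin (of_real A * p) \<noteq> 0"
    proof (cases "Im p = 0")
      case True
      thus ?thesis using that z costc sin_nz by (auto simp: pts_def)
    next
      case False
      show ?thesis
      proof
        assume "sin (of_real A * p) = 0"
        then obtain n :: int where "of_real A * p = of_real (of_int n * pi)"
          by (auto simp: sin_eq_0)
        hence "Im (of_real A * p) = Im (of_real (of_int n * pi))" by (simp only:)
        thus False using False A by simp
      qed
    qed
    thus ?thesis using z0 by (simp add: P_def)
  qed
  have tcz: "(tc k)\<^sup>2 \<noteq> z\<^sup>2" for k
  proof
    assume "(tc k)\<^sup>2 = z\<^sup>2"
    hence "tc k = z \<or> tc k = - z" by (simp only: power2_eq_iff)
    hence "Im (tc k) = Im z \<or> Im (tc k) = - Im z" by auto
    thus False using z by (simp add: tc_def)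
  qed
  have res: "residue \<phi> p = P p / Q' p" if p: "p \<in> pts" for p
    unfolding phi
  proof (rule residue_simple_pole_deriv[OF Pholo Qholo _ _ _ Qder])
    show "open S" "connected S" unfolding S_def by (auto intro: convex_connected)
    show "p \<in> S" using p pts_sub by auto
    show "P p \<noteq> 0" by (rule Pz[OF p])
    show "Q p = 0" using p costc by (auto simp: Q_def pts_def)
    show "Q' p \<noteq> 0"
      using p costc sin_nz[OF costc] tcz z0 A cos_z[of z] z
      by (auto simp: Q'_def pts_def)
  qed
  define X where "X = (\<Sum>k=1..M. exp (- (tc k)\<^sup>2) * (2 * z / ((tc k)\<^sup>2 - z\<^sup>2)))"
  have tm: "e * (2 * z) * S / (- (of_real A * D * S)) = - (1 / of_real A) * (e * (2 * z / D))"
    if "S \<noteq> 0" "D \<noteq> 0" for e S D :: complex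
    using that A by (simp add: field_simps)
  have PQ: "P (tc k) / Q' (tc k) = - (1 / A) * (exp (- (tc k)\<^sup>2) * (2 * z / ((tc k)\<^sup>2 - z\<^sup>2)))"
       "P (- tc k) / Q' (- tc k) = - (1 / A) * (exp (- (tc k)\<^sup>2) * (2 * z / ((tc k)\<^sup>2 - z\<^sup>2)))" for k
    using tm[of "sin (of_real A * tc k)" "(tc k)\<^sup>2 - z\<^sup>2" "exp (- (tc k)\<^sup>2)"] sin_nz[OF costc] tcz[of k] costc
    by (simp_all add: P_def Q'_def)
  have "contour_integral (rectpath (Complex (-R) (-H)) (Complex R H)) \<phi>
      = 2 * pi * \<i> * (\<Sum>p\<in>pts. winding_number (rectpath (Complex (-R) (-H)) (Complex R H)) p * residue \<phi> p)"
  proof (rule Residue_theorem[OF _ _ _ phiholo _ _ pimg])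
    show "open S" "connected S" unfolding S_def by (auto intro: convex_connected)
    show "finite pts" by (simp add: pts_def)
    show "\<forall>w. w \<notin> S \<longrightarrow> winding_number (rectpath (Complex (-R) (-H)) (Complex R H)) w = 0"
      using box_sub R0 H by (auto intro!: winding_number_rectpath_outside)
  qed auto
  also have "(\<Sum>p\<in>pts. winding_number (rectpath (Complex (-R) (-H)) (Complex R H)) p * residue \<phi> p)
      = (\<Sum>p\<in>pts. P p / Q' p)"
  proof (rule sum.cong[OF refl])
    fix p assume p: "p \<in> pts"
    have "winding_number (rectpath (Complex (-R) (-H)) (Complex R H)) p = 1"
      using p inbox by (intro winding_number_rectpath) auto
    thus "winding_number (rectpath (Complex (-R) (-H)) (Complex R H)) p * residue \<phi> p = P p / Q' p"
      using res[OF p] by simp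
  qed
  also have "\<dots> = (\<Sum>p\<in>{z, - z}. P p / Q' p) + ((\<Sum>p\<in>tc ` {1..M}. P p / Q' p) + (\<Sum>p\<in>(\<lambda>k. - tc k) ` {1..M}. P p / Q' p))"
  proof -
    have d1: "{z, - z} \<inter> (tc ` {1..M} \<union> (\<lambda>k. - tc k) ` {1..M}) = {}"
      using z by (auto simp: tc_def complex_eq_iff)
    have d2: "tc ` {1..M} \<inter> (\<lambda>k. - tc k) ` {1..M} = {}"
    proof -
      have "tc i \<noteq> - tc j" if "i \<in> {1..M}" "j \<in> {1..M}" for i j
        using tk(1)[OF that(1)] tk(1)[OF that(2)] by (auto simp: tc_def complex_eq_iff)
      thus ?thesis by blast
    qed
    show ?thesis unfolding pts_def
      by (subst sum.union_disjoint[OF _ _ d1], simp, simp, subst sum.union_disjoint[OF _ _ d2]) simp_all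
  qed
  also have "(\<Sum>p\<in>{z, - z}. P p / Q' p) = 2 * exp (- (z\<^sup>2)) * tan (of_real A * z)"
  proof -
    have "z \<noteq> - z" using z by (auto simp: complex_eq_iff)
    moreover have "P z / Q' z = exp (- (z\<^sup>2)) * tan (of_real A * z)" "P (- z) / Q' (- z) = exp (- (z\<^sup>2)) * tan (of_real A * z)"
      using z0 by (simp_all add: P_def Q'_def tan_def field_simps)
    ultimately show ?thesis by simp
  qed
  also have "(\<Sum>p\<in>tc ` {1..M}. P p / Q' p) = - (1 / A) * X"
  proof (subst sum.reindex)
    show "inj_on tc {1..M}" using A by (auto simp: inj_on_def tc_def t_def)
    show "sum ((\<lambda>p. P p / Q' p) \<circ> tc) {1..M} = - (1 / A) * X"
      unfolding X_def sum_distrib_left by (intro sum.cong) (simp_all only: o_def PQ)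
  qed
  also have "(\<Sum>p\<in>(\<lambda>k. - tc k) ` {1..M}. P p / Q' p) = - (1 / A) * X"
  proof (subst sum.reindex)
    show "inj_on (\<lambda>k. - tc k) {1..M}" using A by (auto simp: inj_on_def tc_def t_def)
    show "sum ((\<lambda>p. P p / Q' p) \<circ> (\<lambda>k. - tc k)) {1..M} = - (1 / A) * X"
      unfolding X_def sum_distrib_left by (intro sum.cong) (simp_all only: o_def PQ)
  qed
  finally show "contour_integral (rectpath (Complex (-R) (-H)) (Complex R H)) \<phi>
       = 2 * pi * \<i> * (2 * exp (- (z\<^sup>2)) * tan (of_real A * z)
            - 2 / A * (\<Sum>k=1..M. exp (- (of_real (t k))\<^sup>2) * (2 * z / ((of_real (t k))\<^sup>2 - z\<^sup>2))))"
    unfolding X_def[unfolded tc_def, symmetric] by (simp add: algebra_simps)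
qed

lemma contour_integral_linepath_odd:
  fixes f :: "complex \<Rightarrow> complex"
  assumes odd: "\<And>w. f (- w) = - f w"
  shows "contour_integral (linepath (- a) (- b)) f = contour_integral (linepath a b) f"
proof -
  have "linepath (- a) (- b) x = - linepath a b x" for x
    by (simp add: linepath_def algebra_simps)
  thus ?thesis
    by (simp add: contour_integral_integral odd algebra_simps)
qed

text \<open>Point reflection maps opposite sides of the rectangle to each other, and for an odd integrand
  it preserves the integrals.\<close>

lemma contour_integral_rectpath_odd:
  fixes f :: "complex \<Rightarrow> complex"
  assumes odd: "\<And>w. f (- w) = - f w"
    and cont: "continuous_on (path_image (rectpath (Complex (-R) (-H)) (Complex R H))) f"
    and R: "R > 0" and H: "H > 0"
  shows "contour_integral (rectpath (Complex (-R) (-H)) (Complex R H)) f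
     = 2 * contour_integral (linepath (Complex R (-H)) (Complex R H)) f
       - 2 * integral {-R..R} (\<lambda>t. f (Complex t H))"
    and "f contour_integrable_on linepath (Complex R (-H)) (Complex R H)"
proof -
  define a1 a2 a3 a4 where "a1 = Complex (-R) (-H)" "a2 = Complex R (-H)" "a3 = Complex R H" "a4 = Complex (-R) H"
  note a = this
  have neg: "a1 = - a3" "a4 = - a2" by (simp_all add: a complex_eq_iff)
  have img: "path_image (rectpath a1 a3) = closed_segment a1 a2 \<union> closed_segment a2 a3 \<union> closed_segment a3 a4 \<union> closed_segment a4 a1"
    by (simp add: rectpath_def Let_def path_image_join a Un_assoc)
  have ci: "f contour_integrable_on linepath a1 a2" "f contour_integrable_on linepath a2 a3"
           "f contour_integrable_on linepath a3 a4" "f contour_integrable_on linepath a4 a1"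
    using cont[folded a] unfolding img
    by (auto intro!: contour_integrable_continuous_linepath elim: continuous_on_subset)
  show "f contour_integrable_on linepath (Complex R (-H)) (Complex R H)"
    using ci by (simp add: a)
  have sub: "Complex t H \<in> path_image (rectpath (Complex (-R) (-H)) (Complex R H))" if "t \<in> {-R..R}" for t
    using that R H by (subst path_image_rectpath) auto
  have cH: "continuous_on {-R..R} (\<lambda>t. f (Complex t H))"
    by (rule continuous_on_compose2[OF cont]) (use sub in \<open>auto simp: Complex_eq intro!: continuous_intros\<close>)
  have "contour_integral (rectpath a1 a3) f = contour_integral (linepath a1 a2) f + contour_integral (linepath a2 a3) f
     + contour_integral (linepath a3 a4) f + contour_integral (linepath a4 a1) f"
    using ci by (simp add: rectpath_def Let_def a)
  also have "contour_integral (linepath a1 a2) f = contour_integral (linepath a3 a4) f"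
    using contour_integral_linepath_odd[of f, OF odd, of a3 a4] by (simp add: neg)
  also have "contour_integral (linepath a4 a1) f = contour_integral (linepath a2 a3) f"
    using contour_integral_linepath_odd[of f, OF odd, of a2 a3] by (simp add: neg)
  also have "contour_integral (linepath a3 a4) f = - integral {-R..R} (\<lambda>t. f (Complex t H))"
  proof -
    have "contour_integral (linepath a4 a3) f = (a3 - a4) * integral {0..1} (\<lambda>x. f (linepath a4 a3 x))"
      by (simp add: contour_integral_integral)
    also have "a3 - a4 = of_real (2 * R)" by (simp add: a complex_eq_iff)
    also have "(\<lambda>x. f (linepath a4 a3 x)) = (\<lambda>x. f (Complex ((2 * R) * x + (-R)) H))"
      by (intro ext arg_cong[where f = f]) (simp add: a linepath_def complex_eq_iff algebra_simps)
    also have "integral {0..1} (\<lambda>x. f (Complex ((2 * R) * x + (-R)) H)) = integral {-R..R} (\<lambda>t. f (Complex t H)) / of_real (2 * R)"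
    proof -
      have "((\<lambda>t. f (Complex t H)) has_integral integral {-R..R} (\<lambda>t. f (Complex t H))) (cbox (-R) R)"
        using integrable_continuous_real[OF cH] by (simp add: has_integral_integral)
      from has_integral_affinity[OF this, of "2 * R" "- R"]
      have "((\<lambda>x. f (Complex ((2 * R) * x + (-R)) H)) has_integral (1 / (2 * R)) *\<^sub>R integral {-R..R} (\<lambda>t. f (Complex t H)))
          ((\<lambda>x. (1 / (2 * R)) *\<^sub>R x + - ((1 / (2 * R)) *\<^sub>R - R)) ` cbox (-R) R)"
        using R by simp
      moreover have "(\<lambda>x. (1 / (2 * R)) *\<^sub>R x + - ((1 / (2 * R)) *\<^sub>R - R)) ` cbox (-R) R = {0..1}"
      proof -
        have "(\<lambda>x. (1 / (2 * R)) *\<^sub>R x + - ((1 / (2 * R)) *\<^sub>R - R)) = (\<lambda>x. (1 / (2 * R)) * x + 1/2)"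
          using R by (simp add: fun_eq_iff)
        moreover have "(1 / (2 * R)) * (- R) + 1/2 = 0" "(1 / (2 * R)) * R + 1/2 = 1" "0 \<le> 1 / (2 * R)" "\<not> R < - R"
          using R by simp_all
        ultimately show ?thesis
          by (simp only: cbox_interval image_affinity_atLeastAtMost atLeastatMost_empty_iff if_True if_False)
             (use R in simp)
      qed
      ultimately have "((\<lambda>x. f (Complex ((2 * R) * x + (-R)) H)) has_integral (1 / (2 * R)) *\<^sub>R integral {-R..R} (\<lambda>t. f (Complex t H))) {0..1}"
        by (simp only:)
      from integral_unique[OF this] show ?thesis by (simp add: scaleR_conv_of_real)
    qed
    finally have "contour_integral (linepath a4 a3) f = integral {-R..R} (\<lambda>t. f (Complex t H))"
      using R by simp
    moreover have "contour_integral (linepath a4 a3) f = - contour_integral (linepath a3 a4) f"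
      by (rule contour_integral_reverse_linepath)
         (use cont[folded a] in \<open>auto simp: img closed_segment_commute elim: continuous_on_subset\<close>)
    ultimately show ?thesis by (metis minus_minus)
  qed
  finally show "contour_integral (rectpath (Complex (-R) (-H)) (Complex R H)) f
     = 2 * contour_integral (linepath (Complex R (-H)) (Complex R H)) f
       - 2 * integral {-R..R} (\<lambda>t. f (Complex t H))"
    by (simp add: a)
qed

text \<open>Where \<open>sin (Re w) = 0\<close>, the tangent is \<open>\<i> * tanh (Im w)\<close>; this controls the vertical sides of
  the rectangle.\<close>

lemma norm_tan_integer_abscissa:
  assumes "sin (Re w) = 0"
  shows "norm (tan w) \<le> 1"
proof -
  have "(cos (Re w))\<^sup>2 = 1" using assms sin_cos_squared_add[of "Re w"] by simp
  hence "(norm (sin w))\<^sup>2 \<le> (norm (cos w))\<^sup>2"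
    using assms by (simp add: cmod_power2 Re_sin Im_sin Re_cos Im_cos power_mult_distrib power_divide power2_diff power2_sum)
  hence "norm (sin w) \<le> norm (cos w)" by (rule power2_le_imp_le) simp
  thus ?thesis by (simp add: tan_def norm_divide divide_le_eq_1)
qed

lemma complex_tan_series:
  assumes "Im w > 0"
  shows "(\<lambda>n. if n = 0 then \<i> else 2 * \<i> * (-1) ^ n * exp (2 * \<i> * of_nat n * w)) sums tan w"
proof -
  define q where "q = exp (2 * \<i> * w)"
  have q1: "norm q < 1" using assms by (simp add: q_def norm_exp_eq_Re)
  have qn: "(- q) ^ n = (-1) ^ n * exp (2 * \<i> * of_nat n * w)" for n
  proof -
    have "(- q) ^ n = (-1) ^ n * q ^ n" by (simp add: power_minus[of q])
    also have "q ^ n = exp (2 * \<i> * of_nat n * w)"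
      by (simp add: q_def exp_of_nat_mult[symmetric] algebra_simps)
    finally show ?thesis .
  qed
  have "(\<lambda>n. (- q) ^ n) sums (1 / (1 - (- q)))"
    using q1 by (intro geometric_sums) simp
  hence "(\<lambda>n. 2 * \<i> * (- q) ^ n) sums (2 * \<i> * (1 / (1 + q)))"
    by (intro sums_mult) simp
  moreover have "(\<lambda>n. if n = 0 then - \<i> else 0) sums (- \<i>)"
    by (rule sums_single)
  ultimately have "(\<lambda>n. 2 * \<i> * (- q) ^ n + (if n = 0 then - \<i> else 0)) sums (2 * \<i> * (1 / (1 + q)) + - \<i>)"
    by (rule sums_add)
  also have "(\<lambda>n. 2 * \<i> * (- q) ^ n + (if n = 0 then - \<i> else 0))
      = (\<lambda>n. if n = 0 then \<i> else 2 * \<i> * (-1) ^ n * exp (2 * \<i> * of_nat n * w))"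
    by (auto simp: fun_eq_iff qn)
  also have "2 * \<i> * (1 / (1 + q)) + - \<i> = tan w"
  proof -
    have ne: "1 + q \<noteq> 0"
      using q1 by (metis add.inverse_unique norm_minus_cancel norm_one less_irrefl)
    define e where "e = exp (\<i> * w)"
    have e0: "e \<noteq> 0" by (simp add: e_def)
    have qe: "q = e * e" by (simp add: q_def e_def algebra_simps flip: exp_add)
    have s: "sin w = (e - 1 / e) / (2 * \<i>)" and c: "cos w = (e + 1 / e) / 2"
      by (simp_all add: sin_exp_eq cos_exp_eq e_def exp_minus inverse_eq_divide)
    have "sin w = (q - 1) / (2 * \<i> * e)" "cos w = (q + 1) / (2 * e)"
      unfolding s c qe using e0 by (simp_all add: field_simps)
    hence t: "tan w = - (\<i> * (q - 1) / (q + 1))" using e0 by (simp add: tan_def)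
    define r where "r = 1 / (1 + q)"
    have r: "r * (1 + q) = 1" using ne by (simp add: r_def)
    have "tan w = - \<i> * (r * (1 + q) - 2 * r)"
    proof -
      have "tan w = - (\<i> * ((q - 1) * r))" unfolding t r_def by (simp add: add.commute)
      also have "(q - 1) * r = r * (1 + q) - 2 * r" by (simp add: algebra_simps)
      finally show ?thesis by simp
    qed
    thus ?thesis unfolding r_def[symmetric] r by (simp add: algebra_simps)
  qed
  finally show ?thesis .
qed

text \<open>The \<open>n\<close>-th term produced by the sampling: the integral of
  \<open>2 sin (z s) exp (- (s + 2 n A)\<^sup>2 / 4)\<close> over \<open>s > 0\<close>, up to the factor \<open>- \<i>\<close>, written through
  the Laplace transform because the two exponentials of the sine are estimated separately.\<close>

definition alias_term :: "real \<Rightarrow> complex \<Rightarrow> nat \<Rightarrow> complex" where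
  "alias_term A z n = exp (- (of_real (real n * A))\<^sup>2)
     * (gauss_laplace (of_real (real n * A) + \<i> * z) - gauss_laplace (of_real (real n * A) - \<i> * z))"

text \<open>Expanding the tangent into its exponential series on the line turns each term into a Cauchy
  integral of a Gaussian, hence into one aliasing term. The series converges uniformly on the line,
  being dominated by a geometric series.\<close>

lemma tan_line_integral:
  fixes A H :: real and z :: complex
  assumes A: "A > 0" and z: "0 < Im z" "Im z < H"
  defines "\<phi> \<equiv> \<lambda>w. exp (- (w\<^sup>2)) * (2 * z / (w\<^sup>2 - z\<^sup>2)) * tan (of_real A * w)"
  shows "integrable lborel (\<lambda>t. \<phi> (Complex t H))"
    and "(\<lambda>n. if n = 0 then sqrt pi * alias_term A z 0 else 2 * sqrt pi * (-1) ^ n * alias_term A z n)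
           sums (LBINT t. \<phi> (Complex t H))"
proof -
  define f where "f = (\<lambda>t. exp (- ((Complex t H)\<^sup>2)) * (2 * z / ((Complex t H)\<^sup>2 - z\<^sup>2)))"
  define c where "c = (\<lambda>n::nat. if n = 0 then \<i> else 2 * \<i> * (-1) ^ n)"
  define e where "e = (\<lambda>(n::nat) t. exp (\<i> * of_real (2 * (real n * A)) * Complex t H))"
  define g where "g = (\<lambda>n t. c n * (f t * e n t))"
  have H: "H > 0" using z by simp
  have norm_e: "norm (e n t) = exp (- (2 * A * H)) ^ n" for n t
    by (simp add: e_def norm_exp_eq_Re exp_of_nat_mult[symmetric] algebra_simps)
  have norm_c: "norm (c n) \<le> 2" for n
    by (simp add: c_def norm_mult norm_power)
  have fe: "f t * e n t = exp (- ((Complex t H)\<^sup>2) + \<i> * of_real (2 * (real n * A)) * Complex t H) / (Complex t H - z)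
             - exp (- ((Complex t H)\<^sup>2) + \<i> * of_real (2 * (real n * A)) * Complex t H) / (Complex t H - (- z))" for n t
  proof -
    have ne: "Complex t H - z \<noteq> 0" "Complex t H + z \<noteq> 0" using z by (auto simp: complex_eq_iff)
    have "2 * z / ((Complex t H)\<^sup>2 - z\<^sup>2) = 1 / (Complex t H - z) - 1 / (Complex t H + z)"
      using ne by (simp add: diff_frac_eq power2_eq_square square_diff_square_factored mult.commute)
    hence "f t = exp (- ((Complex t H)\<^sup>2)) * (1 / (Complex t H - z) - 1 / (Complex t H + z))"
      by (simp only: f_def)
    hence "f t * e n t = (exp (- ((Complex t H)\<^sup>2)) * e n t) * (1 / (Complex t H - z) - 1 / (Complex t H + z))"
      by (simp only: mult_ac)
    also have "exp (- ((Complex t H)\<^sup>2)) * e n t = exp (- ((Complex t H)\<^sup>2) + \<i> * of_real (2 * (real n * A)) * Complex t H)"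
      unfolding e_def by (rule exp_add[symmetric])
    finally show ?thesis
      by (simp only: right_diff_distrib times_divide_eq_right mult_1_right minus_minus diff_minus_eq_add)
  qed
  have fe_int: "integrable lborel (\<lambda>t. f t * e n t)" for n
    unfolding fe using z A by (intro Bochner_Integration.integrable_diff gauss_cauchy_line(1)) auto
  have fe_val: "(LBINT t. f t * e n t) = - \<i> * sqrt pi * alias_term A z n" for n
  proof -
    have "(LBINT t. f t * e n t) = - \<i> * sqrt pi * exp (- ((real n * A)\<^sup>2)) * gauss_laplace (of_real (real n * A) + \<i> * z)
         - (- \<i> * sqrt pi * exp (- ((real n * A)\<^sup>2)) * gauss_laplace (of_real (real n * A) + \<i> * (- z)))"
    proof -
      have u: "0 \<le> real n * A" and mz: "Im (- z) < H" using A z by auto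
      note g1 = gauss_cauchy_line[OF z(2) u] and g2 = gauss_cauchy_line[OF mz u]
      show ?thesis
        unfolding fe by (simp only: Bochner_Integration.integral_diff[OF g1(1) g2(1)] g1(2) g2(2))
    qed
    also have "\<dots> = - \<i> * sqrt pi * alias_term A z n"
      by (simp add: alias_term_def exp_of_real[symmetric] algebra_simps)
    finally show ?thesis .
  qed
  have f_int: "integrable lborel f"
    using fe_int[of 0] by (simp add: e_def)
  have q: "exp (- (2 * A * H)) < 1" using A H by simp
  have g_int: "integrable lborel (g n)" for n
    unfolding g_def using fe_int by (intro integrable_mult_right)
  have norm_g: "norm (g n t) \<le> 2 * (norm (f t) * exp (- (2 * A * H)) ^ n)" for n t
    unfolding g_def norm_mult norm_e using norm_c[of n] by (intro mult_right_mono) auto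
  have sum_geo: "summable (\<lambda>n. x * exp (- (2 * A * H)) ^ n)" for x :: real
    using q by (intro summable_mult summable_geometric) auto
  have summ: "summable (\<lambda>n. norm (g n t))" for t
  proof (rule summable_comparison_test')
    show "summable (\<lambda>n. (2 * norm (f t)) * exp (- (2 * A * H)) ^ n)" by (rule sum_geo)
    show "norm (norm (g n t)) \<le> (2 * norm (f t)) * exp (- (2 * A * H)) ^ n" if "n \<ge> 0" for n
      using norm_g[of n t] by simp
  qed
  have summ_int: "summable (\<lambda>n. LBINT t. norm (g n t))"
  proof (rule summable_comparison_test')
    show "summable (\<lambda>n. (2 * (LBINT t. norm (f t))) * exp (- (2 * A * H)) ^ n)" by (rule sum_geo)
    fix n :: nat
    have "(LBINT t. norm (g n t)) \<le> (LBINT t. 2 * (norm (f t) * exp (- (2 * A * H)) ^ n))"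
      by (intro integral_mono integrable_norm g_int integrable_mult_right integrable_mult_left f_int norm_g)
    also have "\<dots> = (2 * (LBINT t. norm (f t))) * exp (- (2 * A * H)) ^ n"
      by simp
    finally show "norm (LBINT t. norm (g n t)) \<le> (2 * (LBINT t. norm (f t))) * exp (- (2 * A * H)) ^ n"
      by (simp add: integral_nonneg_AE)
  qed
  have suminf_g: "(\<Sum>n. g n t) = \<phi> (Complex t H)" for t
  proof -
    have "Im (of_real A * Complex t H) > 0" using A H by simp
    from sums_mult[OF complex_tan_series[OF this], of "f t"]
    have "(\<lambda>n. f t * (if n = 0 then \<i> else 2 * \<i> * (-1) ^ n * exp (2 * \<i> * of_nat n * (of_real A * Complex t H))))
        sums (f t * tan (of_real A * Complex t H))" .
    also have "(\<lambda>n. f t * (if n = 0 then \<i> else 2 * \<i> * (-1) ^ n * exp (2 * \<i> * of_nat n * (of_real A * Complex t H)))) = (\<lambda>n. g n t)"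
      by (auto simp: fun_eq_iff g_def c_def e_def algebra_simps)
    finally show ?thesis by (simp add: sums_iff \<phi>_def f_def)
  qed
  show "integrable lborel (\<lambda>t. \<phi> (Complex t H))"
    using integrable_suminf[OF g_int _ summ_int] summ by (simp add: suminf_g)
  have "(\<lambda>n. LBINT t. g n t) sums (LBINT t. \<Sum>n. g n t)"
    using sums_integral[OF g_int _ summ_int] summ by simp
  also have "(\<lambda>n. LBINT t. g n t) = (\<lambda>n. if n = 0 then sqrt pi * alias_term A z 0 else 2 * sqrt pi * (-1) ^ n * alias_term A z n)"
  proof
    fix n :: nat
    have gv: "(LBINT t. g n t) = c n * (- \<i> * sqrt pi * alias_term A z n)"
      by (simp only: g_def integral_mult_right_zero fe_val)
    have ii: "\<i> * (\<i> * x) = - x" for x by (simp flip: mult.assoc)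
    show "(LBINT t. g n t) = (if n = 0 then sqrt pi * alias_term A z 0 else 2 * sqrt pi * (-1) ^ n * alias_term A z n)"
      unfolding gv by (simp add: c_def ii mult_ac)
  qed
  finally show "(\<lambda>n. if n = 0 then sqrt pi * alias_term A z 0 else 2 * sqrt pi * (-1) ^ n * alias_term A z n)
           sums (LBINT t. \<phi> (Complex t H))"
    by (simp add: suminf_g)
qed

text \<open>Letting the rectangle grow horizontally, its vertical sides disappear because of the factor
  \<open>exp (- w\<^sup>2)\<close>.\<close>

lemma midpoint_sum_tendsto:
  fixes A H :: real and z :: complex
  assumes A: "A > 0" and z: "0 < Im z" "Im z < H"
  defines "\<phi> \<equiv> \<lambda>w. exp (- (w\<^sup>2)) * (2 * z / (w\<^sup>2 - z\<^sup>2)) * tan (of_real A * w)"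
    and "t \<equiv> \<lambda>k::nat. (real k - 1/2) * pi / A"
  shows "(\<lambda>M. \<Sum>k=1..M. exp (- (of_real (t k))\<^sup>2) * (2 * z / ((of_real (t k))\<^sup>2 - z\<^sup>2)))
     \<longlonglongrightarrow> of_real A * (exp (- (z\<^sup>2)) * tan (of_real A * z) - \<i> / (2 * pi) * (LBINT t. \<phi> (Complex t H)))"
proof -
  define R where "R = (\<lambda>M::nat. real M * pi / A)"
  define V where "V = (\<lambda>M. contour_integral (linepath (Complex (R M) (-H)) (Complex (R M) H)) \<phi>)"
  define I where "I = (\<lambda>M. integral {- R M..R M} (\<lambda>t. \<phi> (Complex t H)))"
  define S where "S = (\<lambda>M. \<Sum>k=1..M. exp (- (of_real (t k))\<^sup>2) * (2 * z / ((of_real (t k))\<^sup>2 - z\<^sup>2)))"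
  have H: "H > 0" using z by simp
  have odd: "\<phi> (- w) = - \<phi> w" for w by (simp add: \<phi>_def)
  have Rlim: "filterlim R at_top sequentially"
  proof -
    have "filterlim (\<lambda>M. (pi / A) * real M) at_top sequentially"
      using A by (intro filterlim_tendsto_pos_mult_at_top[OF tendsto_const] filterlim_real_sequentially) auto
    thus ?thesis by (simp add: R_def mult.commute)
  qed
  have evR: "\<forall>\<^sub>F M in sequentially. R M \<ge> \<bar>Re z\<bar> + 1"
    using Rlim by (simp add: filterlim_at_top)
  have key: "S M = of_real A * (exp (- (z\<^sup>2)) * tan (of_real A * z) - \<i> / (2 * pi) * (I M - V M))"
    if "R M \<ge> \<bar>Re z\<bar> + 1" for M
  proof -
    have rM: "\<bar>Re z\<bar> < real M * pi / A" and R0: "R M > 0" using that by (auto simp: R_def)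
    have RM: "R M = real M * pi / A" by (simp add: R_def)
    have SM: "(\<Sum>k=1..M. exp (- (of_real ((real k - 1/2) * pi / A))\<^sup>2) * (2 * z / ((of_real ((real k - 1/2) * pi / A))\<^sup>2 - z\<^sup>2))) = S M"
      by (simp only: S_def t_def)
    note rt = midpoint_residue_theorem[OF A z rM, folded \<phi>_def RM, unfolded SM]
    have eq: "2 * V M - 2 * I M = 2 * pi * \<i> * (2 * exp (- (z\<^sup>2)) * tan (of_real A * z) - 2 / A * S M)"
      using rt(1) contour_integral_rectpath_odd(1)[of \<phi>, OF odd rt(2) R0 H] by (simp only: V_def I_def)
    define E where "E = exp (- (z\<^sup>2)) * tan (of_real A * z)"
    have "2 * (V M - I M) = 2 * (2 * pi * \<i> * (E - S M / A))"
      using eq unfolding E_def by (simp add: algebra_simps)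
    hence "V M - I M = 2 * pi * \<i> * (E - S M / A)"
      by (subst (asm) mult_cancel_left) simp
    hence "I M - V M = - (2 * pi * \<i> * (E - S M / A))"
      by (metis minus_diff_eq)
    hence "\<i> / (2 * pi) * (I M - V M) = E - S M / A" by simp
    thus ?thesis using A unfolding E_def[symmetric] by simp
  qed
  have Vb: "norm (V M) \<le> exp (H\<^sup>2 - (R M)\<^sup>2) * (2 * norm z) * (2 * H)" if "R M \<ge> \<bar>Re z\<bar> + 1" for M
  proof -
    have rM: "\<bar>Re z\<bar> < real M * pi / A" and R0: "R M > 0" using that by (auto simp: R_def)
    have RM: "R M = real M * pi / A" by (simp add: R_def)
    have SM: "(\<Sum>k=1..M. exp (- (of_real ((real k - 1/2) * pi / A))\<^sup>2) * (2 * z / ((of_real ((real k - 1/2) * pi / A))\<^sup>2 - z\<^sup>2))) = S M"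
      by (simp only: S_def t_def)
    note rt = midpoint_residue_theorem[OF A z rM, folded \<phi>_def RM, unfolded SM]
    have "(\<phi> has_contour_integral V M) (linepath (Complex (R M) (-H)) (Complex (R M) H))"
      unfolding V_def
      by (rule has_contour_integral_integral, rule contour_integral_rectpath_odd(2)[of \<phi>, OF odd rt(2) R0 H])
    hence "norm (V M) \<le> (exp (H\<^sup>2 - (R M)\<^sup>2) * (2 * norm z)) * norm (Complex (R M) H - Complex (R M) (-H))"
    proof (rule has_contour_integral_bound_linepath)
      fix w assume "w \<in> closed_segment (Complex (R M) (-H)) (Complex (R M) H)"
      hence w: "Re w = R M" "\<bar>Im w\<bar> \<le> H"
        using H by (auto simp: closed_segment_same_Re closed_segment_eq_real_ivl)
      have "(Im w)\<^sup>2 \<le> H\<^sup>2" using w H by (metis abs_le_square_iff abs_of_pos)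
      hence 1: "norm (exp (- (w\<^sup>2))) \<le> exp (H\<^sup>2 - (R M)\<^sup>2)"
        by (simp add: norm_exp_eq_Re power2_eq_square w)
      have "norm (w - z) \<ge> 1" "norm (w + z) \<ge> 1"
        using abs_Re_le_cmod[of "w - z"] abs_Re_le_cmod[of "w + z"] that w by auto
      hence "norm (w - z) * norm (w + z) \<ge> 1" using mult_mono[of 1 "norm (w - z)" 1 "norm (w + z)"] by simp
      hence "norm (w\<^sup>2 - z\<^sup>2) \<ge> 1"
        by (simp add: power2_eq_square square_diff_square_factored norm_mult mult.commute)
      hence 2: "norm (2 * z / (w\<^sup>2 - z\<^sup>2)) \<le> 2 * norm z"
        by (simp add: norm_divide norm_mult divide_le_eq mult_le_cancel_left1)
      have "sin (Re (of_real A * w)) = 0" using A by (simp add: w R_def)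
      hence 3: "norm (tan (of_real A * w)) \<le> 1" by (rule norm_tan_integer_abscissa)
      show "norm (\<phi> w) \<le> exp (H\<^sup>2 - (R M)\<^sup>2) * (2 * norm z)"
        unfolding \<phi>_def norm_mult[of _ "tan _"] norm_mult[of "exp _"]
        using mult_mono[OF mult_mono[OF 1 2] 3] by simp
    qed simp
    also have "norm (Complex (R M) H - Complex (R M) (-H)) = 2 * H"
      using H by (simp add: cmod_def real_sqrt_mult)
    finally show ?thesis .
  qed
  have V0: "V \<longlonglongrightarrow> 0"
  proof (rule Lim_null_comparison)
    show "\<forall>\<^sub>F M in sequentially. norm (V M) \<le> exp (H\<^sup>2 - (R M)\<^sup>2) * (2 * norm z) * (2 * H)"
      using evR Vb by (auto elim: eventually_mono)
    have "filterlim (\<lambda>M. - H\<^sup>2 + (R M) * (R M)) at_top sequentially"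
      by (intro filterlim_tendsto_add_at_top[OF tendsto_const] filterlim_at_top_mult_at_top Rlim)
    hence "filterlim (\<lambda>M. - (- H\<^sup>2 + (R M) * (R M))) at_bot sequentially"
      by (simp only: filterlim_uminus_at_bot minus_minus)
    hence "filterlim (\<lambda>M. H\<^sup>2 - (R M)\<^sup>2) at_bot sequentially"
      by (simp add: power2_eq_square)
    hence "(\<lambda>M. exp (H\<^sup>2 - (R M)\<^sup>2)) \<longlonglongrightarrow> 0"
      by (rule filterlim_compose[OF exp_at_bot])
    hence "(\<lambda>M. exp (H\<^sup>2 - (R M)\<^sup>2) * (2 * norm z) * (2 * H)) \<longlonglongrightarrow> 0 * (2 * norm z) * (2 * H)"
      by (intro tendsto_mult tendsto_const)
    thus "(\<lambda>M. exp (H\<^sup>2 - (R M)\<^sup>2) * (2 * norm z) * (2 * H)) \<longlonglongrightarrow> 0" by simp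
  qed
  have I_lim: "I \<longlonglongrightarrow> (LBINT t. \<phi> (Complex t H))"
  proof -
    have int: "integrable lborel (\<lambda>t. \<phi> (Complex t H))"
      unfolding \<phi>_def by (rule tan_line_integral(1)[OF A z])
    have "(\<lambda>M. LBINT t:{- R M..R M}. \<phi> (Complex t H)) \<longlonglongrightarrow> (LBINT t. \<phi> (Complex t H))"
      unfolding set_lebesgue_integral_def
    proof (rule integral_dominated_convergence)
      show "integrable lborel (\<lambda>t. norm (\<phi> (Complex t H)))" using int by (rule integrable_norm)
      show "AE t in lborel. (\<lambda>M. indicat_real {- R M..R M} t *\<^sub>R \<phi> (Complex t H)) \<longlonglongrightarrow> \<phi> (Complex t H)"
      proof (rule AE_I2)
        fix t :: real
        have "\<forall>\<^sub>F M in sequentially. R M \<ge> \<bar>t\<bar>"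
          using Rlim by (simp add: filterlim_at_top)
        hence "\<forall>\<^sub>F M in sequentially. indicat_real {- R M..R M} t *\<^sub>R \<phi> (Complex t H) = \<phi> (Complex t H)"
          by eventually_elim (auto simp: indicator_def abs_le_iff)
        thus "(\<lambda>M. indicat_real {- R M..R M} t *\<^sub>R \<phi> (Complex t H)) \<longlonglongrightarrow> \<phi> (Complex t H)"
          by (rule tendsto_eventually)
      qed
      show "AE t in lborel. norm (indicat_real {- R M..R M} t *\<^sub>R \<phi> (Complex t H)) \<le> norm (\<phi> (Complex t H))" for M
        by (auto split: split_indicator)
    qed (use borel_measurable_integrable[OF int] in auto)
    moreover have "(LBINT t:{- R M..R M}. \<phi> (Complex t H)) = I M" for M
      unfolding I_def
      by (rule set_borel_integral_eq_integral, unfold set_integrable_def, rule integrable_mult_indicator[OF _ int]) simp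
    ultimately show ?thesis by simp
  qed
  have "(\<lambda>M. of_real A * (exp (- (z\<^sup>2)) * tan (of_real A * z) - \<i> / (2 * pi) * (I M - V M)))
      \<longlonglongrightarrow> of_real A * (exp (- (z\<^sup>2)) * tan (of_real A * z) - \<i> / (2 * pi) * ((LBINT t. \<phi> (Complex t H)) - 0))"
    by (intro tendsto_intros I_lim V0)
  hence "S \<longlonglongrightarrow> of_real A * (exp (- (z\<^sup>2)) * tan (of_real A * z) - \<i> / (2 * pi) * ((LBINT t. \<phi> (Complex t H)) - 0))"
    by (rule Lim_transform_eventually) (use evR in eventually_elim, auto simp: key)
  thus ?thesis by (simp add: S_def)
qed

section \<open>Fresnel integrals and their approximants in complex form\<close>

text \<open>The term of index zero is not an error: it is a multiple of Dawson's integral at \<open>z\<close>, and as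
  \<open>(\<i> z)\<^sup>2 = - \<i> \<pi> x\<^sup>2 / 2\<close>, the primitive of \<open>exp (- w\<^sup>2)\<close> at \<open>\<i> z\<close> is the pair of Fresnel
  integrals up to a constant factor.\<close>

lemma fresnel_alias_term_zero:
  fixes x :: real
  defines "z \<equiv> (1 + \<i>) * of_real (sqrt pi * x / 2)"
  shows "exp (z\<^sup>2) * alias_term A z 0 = - 2 * \<i> * (1 + \<i>) * sqrt pi * Complex (fresnel_C x) (fresnel_S x)"
proof -
  obtain E :: "complex \<Rightarrow> complex" where E: "\<And>w. (E has_field_derivative exp (- (w\<^sup>2))) (at w)" "\<And>w. E (- w) = - E w"
    using gauss_primitive_exists by blast
  have E0: "E 0 = 0" using E(2)[of 0] by simp
  define k where "k = \<i> * (1 + \<i>) * of_real (sqrt pi / 2)"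
  have k0: "k \<noteq> 0" by (simp add: k_def complex_eq_iff)
  have k2: "k\<^sup>2 = - (\<i> * of_real (pi / 2))"
    by (simp add: k_def power2_eq_square complex_eq_iff)
  define G where "G = (\<lambda>t::real. E (k * of_real t) / k)"
  have Gd: "(G has_vector_derivative cis (pi * t\<^sup>2 / 2)) (at t)" for t
  proof -
    have "((\<lambda>w. E (k * w) / k) has_field_derivative exp (- ((k * of_real t)\<^sup>2)) * k / k) (at (of_real t))"
      by (intro DERIV_cdivide DERIV_chain2[where f = E, OF E(1)]) (auto intro!: derivative_eq_intros)
    hence "((\<lambda>t::real. E (k * of_real t) / k) has_vector_derivative exp (- ((k * of_real t)\<^sup>2)) * k / k) (at t)"
      by (rule has_vector_derivative_real_field)
    also have "exp (- ((k * of_real t)\<^sup>2)) * k / k = cis (pi * t\<^sup>2 / 2)"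
      using k0 by (simp add: power_mult_distrib k2 cis_conv_exp mult_ac)
    finally show ?thesis by (simp add: G_def)
  qed
  have "fresnel_C x = Re (G x) - Re (G 0)"
    unfolding fresnel_C_def zero_ereal_def
  proof (rule interval_integral_FTC_finite)
    show "continuous_on {min 0 x..max 0 x} (\<lambda>t. cos (pi * t\<^sup>2 / 2))"
      by (intro continuous_intros) auto
    show "((\<lambda>t. Re (G t)) has_vector_derivative cos (pi * t\<^sup>2 / 2)) (at t within {min 0 x..max 0 x})" for t
      using bounded_linear.has_vector_derivative[OF bounded_linear_Re Gd[of t]]
      by (simp add: has_vector_derivative_at_within)
  qed
  moreover have "fresnel_S x = Im (G x) - Im (G 0)"
    unfolding fresnel_S_def zero_ereal_def
  proof (rule interval_integral_FTC_finite)
    show "continuous_on {min 0 x..max 0 x} (\<lambda>t. sin (pi * t\<^sup>2 / 2))"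
      by (intro continuous_intros) auto
    show "((\<lambda>t. Im (G t)) has_vector_derivative sin (pi * t\<^sup>2 / 2)) (at t within {min 0 x..max 0 x})" for t
      using bounded_linear.has_vector_derivative[OF bounded_linear_Im Gd[of t]]
      by (simp add: has_vector_derivative_at_within)
  qed
  ultimately have W: "Complex (fresnel_C x) (fresnel_S x) = G x"
    by (simp add: G_def E0 complex_eq_iff)
  have iz: "\<i> * z = k * of_real x" by (simp add: z_def k_def)
  have sq: "(\<i> * z)\<^sup>2 = - (z\<^sup>2)" "(- (\<i> * z))\<^sup>2 = - (z\<^sup>2)" by (simp_all add: power_mult_distrib)
  have "exp (z\<^sup>2) * alias_term A z 0 = exp (z\<^sup>2) * exp (- (z\<^sup>2)) *
     ((LBINT s:{0<..}. exp (- ((of_real s / 2 + \<i> * z)\<^sup>2))) - (LBINT s:{0<..}. exp (- ((of_real s / 2 + (- (\<i> * z)))\<^sup>2))))"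
    unfolding alias_term_def by (simp add: gauss_laplace_eq sq algebra_simps)
  also have "\<dots> = 2 * (E (- (\<i> * z)) - E (\<i> * z))"
    unfolding half_line_gauss_difference[OF E(1)] by (simp flip: exp_add)
  also have "\<dots> = - 4 * k * G x"
    using k0 by (simp add: E(2) iz G_def)
  also have "- 4 * k * G x = - 2 * \<i> * (1 + \<i>) * sqrt pi * G x"
    by (simp add: k_def)
  finally show ?thesis by (simp only: W)
qed

lemma fresnel_midpoint_limit:
  fixes A x :: real
  assumes A: "A > 0" and x: "x > 0"
  defines "z \<equiv> (1 + \<i>) * of_real (sqrt pi * x / 2)"
    and "t \<equiv> \<lambda>k::nat. (real k - 1/2) * pi / A"
  obtains T where "(\<lambda>n. (-1) ^ Suc n * alias_term A z (Suc n)) sums T"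
    and "(\<lambda>M. \<Sum>k=1..M. exp (z\<^sup>2 - (of_real (t k))\<^sup>2) * (2 * z / ((of_real (t k))\<^sup>2 - z\<^sup>2)) / A)
        \<longlonglongrightarrow> tan (of_real A * z) - (1 + \<i>) * Complex (fresnel_C x) (fresnel_S x) - \<i> / sqrt pi * exp (z\<^sup>2) * T"
proof -
  \<comment> \<open>Any height above the pole gives the same formula.\<close>
  define H where "H = Im z + 1"
  have z: "0 < Im z" "Im z < H" using x by (simp_all add: z_def H_def)
  define I where "I = (LBINT t. exp (- ((Complex t H)\<^sup>2)) * (2 * z / ((Complex t H)\<^sup>2 - z\<^sup>2)) * tan (of_real A * Complex t H))"
  let ?c = "2 * complex_of_real (sqrt pi)"
  have "(\<lambda>n. if n = 0 then sqrt pi * alias_term A z 0 else 2 * sqrt pi * (-1) ^ n * alias_term A z n) sums I"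
    unfolding I_def by (rule tan_line_integral(2)[OF A z])
  hence "(\<lambda>n. 2 * sqrt pi * (-1) ^ Suc n * alias_term A z (Suc n)) sums (I - sqrt pi * alias_term A z 0)"
    using sums_Suc_iff[of "\<lambda>n. if n = 0 then sqrt pi * alias_term A z 0 else 2 * sqrt pi * (-1) ^ n * alias_term A z n"
        "I - sqrt pi * alias_term A z 0"] by simp
  hence "(\<lambda>n. ?c * ((-1) ^ Suc n * alias_term A z (Suc n))) sums (I - sqrt pi * alias_term A z 0)"
    by (simp add: mult.assoc)
  from sums_divide[OF this, of ?c]
  have T: "(\<lambda>n. (-1) ^ Suc n * alias_term A z (Suc n)) sums ((I - sqrt pi * alias_term A z 0) / ?c)"
    by simp
  define T where "T = (I - sqrt pi * alias_term A z 0) / ?c"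
  have I: "I = sqrt pi * alias_term A z 0 + ?c * T" by (simp add: T_def)
  let ?f = "\<lambda>k. exp (- (of_real (t k))\<^sup>2) * (2 * z / ((of_real (t k))\<^sup>2 - z\<^sup>2))"
  have "(\<lambda>M. \<Sum>k=1..M. ?f k) \<longlonglongrightarrow> of_real A * (exp (- (z\<^sup>2)) * tan (of_real A * z) - \<i> / (2 * pi) * I)"
    unfolding I_def t_def by (rule midpoint_sum_tendsto[OF A z])
  hence "(\<lambda>M. exp (z\<^sup>2) / A * (\<Sum>k=1..M. ?f k)) \<longlonglongrightarrow> exp (z\<^sup>2) / A * (of_real A * (exp (- (z\<^sup>2)) * tan (of_real A * z) - \<i> / (2 * pi) * I))"
    by (intro tendsto_mult tendsto_const)
  also have "(\<lambda>M. exp (z\<^sup>2) / A * (\<Sum>k=1..M. ?f k)) = (\<lambda>M. \<Sum>k=1..M. exp (z\<^sup>2 - (of_real (t k))\<^sup>2) * (2 * z / ((of_real (t k))\<^sup>2 - z\<^sup>2)) / A)"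
    by (simp add: sum_distrib_left exp_diff exp_minus field_simps)
  also have "exp (z\<^sup>2) / A * (of_real A * (exp (- (z\<^sup>2)) * tan (of_real A * z) - \<i> / (2 * pi) * I))
     = tan (of_real A * z) - \<i> / (2 * pi) * (sqrt pi * (exp (z\<^sup>2) * alias_term A z 0) + ?c * (exp (z\<^sup>2) * T))"
  proof -
    have "exp (z\<^sup>2) / A * (of_real A * (exp (- (z\<^sup>2)) * tan (of_real A * z) - \<i> / (2 * pi) * I))
       = exp (z\<^sup>2) * exp (- (z\<^sup>2)) * tan (of_real A * z) - \<i> / (2 * pi) * (exp (z\<^sup>2) * I)"
      using A by (simp add: algebra_simps)
    also have "exp (z\<^sup>2) * exp (- (z\<^sup>2)) = 1" by (simp flip: exp_add)
    also have "exp (z\<^sup>2) * I = sqrt pi * (exp (z\<^sup>2) * alias_term A z 0) + ?c * (exp (z\<^sup>2) * T)"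
      unfolding I by (simp add: algebra_simps)
    finally show ?thesis by simp
  qed
  also have "\<dots> = tan (of_real A * z) - (1 + \<i>) * Complex (fresnel_C x) (fresnel_S x) - \<i> / sqrt pi * exp (z\<^sup>2) * T"
  proof -
    have ss: "complex_of_real (sqrt pi) * of_real (sqrt pi) = of_real pi"
      by (simp flip: of_real_mult)
    have s0: "complex_of_real (sqrt pi) \<noteq> 0" "complex_of_real pi \<noteq> 0" by auto
    have 1: "\<i> / (2 * pi) * (sqrt pi * (- 2 * \<i> * (1 + \<i>) * sqrt pi * X)) = (1 + \<i>) * X" for X
    proof -
      have "j / (2 * P) * (r * (- 2 * j * (1 + j) * r * X)) = - (j * j) * (1 + j) * X * ((r * r) / P)"
        if "P \<noteq> 0" for j r P :: complex
        using that by (simp add: field_simps)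
      from this[of "of_real pi" \<i> "of_real (sqrt pi)"] show ?thesis unfolding ss by simp
    qed
    have 2: "\<i> / (2 * pi) * (?c * (exp (z\<^sup>2) * T)) = \<i> / sqrt pi * exp (z\<^sup>2) * T"
    proof -
      have "j / (2 * (r * r)) * (2 * r * (Y * T)) = j / r * Y * T" if "r \<noteq> 0" for j r Y :: complex
        using that by (simp add: field_simps)
      from this[OF s0(1), of \<i> "exp (z\<^sup>2)"] show ?thesis unfolding ss by simp
    qed
    have 3: "X - j * (Y + Z) = X - (j * Y + j * Z)" for X Y Z j :: complex
      by (simp add: distrib_left)
    show ?thesis
      unfolding 3 fresnel_alias_term_zero[of x A, folded z_def] 1 2 by simp
  qed
  finally show ?thesis using that[of T] T by (simp add: T_def)
qed

lemma tan_diagonal: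
  fixes u :: real
  shows "tan ((1 + \<i>) * of_real (u / 2)) = (of_real (sin u) + \<i> * of_real (sinh u)) / of_real (cos u + cosh u)"
proof -
  define w where "w = (1 + \<i>) * complex_of_real (u / 2)"
  define p where "p = u / 2"
  have w: "Re w = p" "Im w = p" by (simp_all add: w_def p_def)
  have rs: "Re (sin w) = sin p * cosh p" "Im (sin w) = cos p * sinh p"
          "Re (cos w) = cos p * cosh p" "Im (cos w) = - (sin p * sinh p)"
    by (simp_all add: Re_sin Im_sin Re_cos Im_cos w cosh_def sinh_def field_simps)
  have u: "u = 2 * p" by (simp add: p_def)
  have su: "sin u = 2 * sin p * cos p" "sinh u = 2 * sinh p * cosh p"
    unfolding u by (simp_all add: sin_double sinh_double)
  have tr: "(sin p)\<^sup>2 = 1 - (cos p)\<^sup>2" "(cosh p)\<^sup>2 = 1 + (sinh p)\<^sup>2"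
    by (simp_all add: sin_squared_eq cosh_square_eq)
  have num: "sin w * cnj (cos w) = (of_real (sin u) + \<i> * of_real (sinh u)) / 2"
  proof (rule complex_eqI)
    have "Re (sin w * cnj (cos w)) = sin p * cos p * ((cosh p)\<^sup>2 - (sinh p)\<^sup>2)"
      by (simp add: rs power2_eq_square algebra_simps)
    thus "Re (sin w * cnj (cos w)) = Re ((of_real (sin u) + \<i> * of_real (sinh u)) / 2)"
      by (simp add: tr su)
    have "Im (sin w * cnj (cos w)) = sinh p * cosh p * ((sin p)\<^sup>2 + (cos p)\<^sup>2)"
      unfolding distrib_left by (simp add: rs power2_eq_square mult_ac del: sin_cos_squared_add)
    thus "Im (sin w * cnj (cos w)) = Im ((of_real (sin u) + \<i> * of_real (sinh u)) / 2)"
      by (simp add: su)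
  qed
  have den: "(norm (cos w))\<^sup>2 = (cos u + cosh u) / 2"
  proof -
    have "(norm (cos w))\<^sup>2 = (cos p)\<^sup>2 * (cosh p)\<^sup>2 + (sin p)\<^sup>2 * (sinh p)\<^sup>2"
      by (simp add: cmod_power2 rs power_mult_distrib)
    also have "\<dots> = (cos p)\<^sup>2 + (sinh p)\<^sup>2" by (simp add: tr algebra_simps)
    also have "\<dots> = (cos u + cosh u) / 2"
      unfolding u by (simp add: cos_double_cos cosh_double_cosh tr)
    finally show ?thesis .
  qed
  have "tan w = sin w * cnj (cos w) / of_real ((norm (cos w))\<^sup>2)"
    unfolding tan_def by (subst complex_div_cnj) simp
  also have "\<dots> = (of_real (sin u) + \<i> * of_real (sinh u)) / of_real (cos u + cosh u)"
  proof -
    have "X / 2 / of_real (y / 2) = X / complex_of_real y" for X y by simp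
    thus ?thesis unfolding num den .
  qed
  finally show ?thesis by (simp only: w_def)
qed

text \<open>Up to the factor \<open>1 + \<i>\<close> the approximants are the real and imaginary parts of the right-hand
  side of the midpoint formula, with the sum over the nodes cut off after \<open>N\<close> terms: here
  \<open>z\<^sup>2 = \<i> \<sigma>\<close> with \<open>\<sigma> = \<pi> x\<^sup>2 / 2\<close>.\<close>

lemma approx_closed_form:
  fixes x :: real and N :: nat
  defines "z \<equiv> (1 + \<i>) * of_real (sqrt pi * x / 2)"
  assumes x: "x > 0"
  shows "(1 + \<i>) * Complex (C_approx N x) (S_approx N x)
     = tan (of_real (A_rt N) * z)
       - (\<Sum>k=1..N. exp (z\<^sup>2 - (of_real (t_node N k))\<^sup>2) * (2 * z / ((of_real (t_node N k))\<^sup>2 - z\<^sup>2)) / of_real (A_rt N))"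
proof -
  define A where "A = A_rt N"
  define u where "u = sqrt pi * A * x"
  define \<sigma> where "\<sigma> = pi / 2 * x\<^sup>2"
  define a where "a = a_sum N \<sigma>"
  define b where "b = b_sum N \<sigma>"
  define r where "r = sqrt pi * x / A"
  define D where "D = cos u + cosh u"
  have A: "A > 0" by (simp add: A_def A_rt_def)
  have \<sigma>: "\<sigma> > 0" using x by (simp add: \<sigma>_def)
  have z2: "z\<^sup>2 = \<i> * of_real \<sigma>"
    by (simp add: z_def \<sigma>_def power2_eq_square complex_eq_iff)
  have Az: "of_real A * z = (1 + \<i>) * of_real (u / 2)"
    by (simp add: z_def u_def)
  define F where "F = (\<lambda>t::real. Complex (t\<^sup>2 * exp (- t\<^sup>2) / (\<sigma>\<^sup>2 + t ^ 4)) (\<sigma> * (exp (- t\<^sup>2) / (\<sigma>\<^sup>2 + t ^ 4))))"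
  have tm: "exp (z\<^sup>2 - (of_real t)\<^sup>2) * (2 * z / ((of_real t)\<^sup>2 - z\<^sup>2)) / A = (2 * z * cis \<sigma> / A) * F t" for t
  proof -
    have q: "\<sigma>\<^sup>2 + t ^ 4 \<noteq> 0"
      using \<sigma> by (metis add_pos_nonneg less_irrefl zero_le_even_power even_numeral zero_less_power)
    have F: "F t = exp (- t\<^sup>2) * (of_real (t\<^sup>2) + \<i> * of_real \<sigma>) / of_real (\<sigma>\<^sup>2 + t ^ 4)"
      by (simp add: F_def complex_eq_iff Re_divide_of_real Im_divide_of_real del: of_real_add)
    have dq: "((of_real t)\<^sup>2 - z\<^sup>2) * (of_real (t\<^sup>2) + \<i> * of_real \<sigma>) = of_real (\<sigma>\<^sup>2 + t ^ 4)"
      unfolding z2 by (simp add: complex_eq_iff power2_eq_square power4_eq_xxxx algebra_simps)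
    hence d0: "(of_real t)\<^sup>2 - z\<^sup>2 \<noteq> 0" "of_real (t\<^sup>2) + \<i> * of_real \<sigma> \<noteq> 0"
      using q by (metis mult_eq_0_iff of_real_eq_0_iff)+
    have "(of_real (t\<^sup>2) + \<i> * of_real \<sigma>) / of_real (\<sigma>\<^sup>2 + t ^ 4) = 1 / ((of_real t)\<^sup>2 - z\<^sup>2)"
      unfolding dq[symmetric] using d0(2) by simp
    hence F2: "F t = exp (- t\<^sup>2) * (1 / ((of_real t)\<^sup>2 - z\<^sup>2))"
      unfolding F by (metis times_divide_eq_right)
    have "exp (z\<^sup>2 - (of_real t)\<^sup>2) = cis \<sigma> * of_real (exp (- t\<^sup>2))"
      by (simp add: z2 cis_conv_exp exp_of_real[symmetric] exp_diff exp_minus divide_inverse)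
    thus ?thesis unfolding F2 by (simp add: mult_ac)
  qed
  have sumF: "(\<Sum>k=1..N. F (t_node N k)) = Complex b a"
    by (simp add: complex_eq_iff Re_sum Im_sum F_def a_def b_def a_sum_def b_sum_def sum_distrib_left)
  have zA: "2 * z / A = (1 + \<i>) * of_real r"
    by (simp add: z_def r_def)
  define p where "p = sin u / D"
  define q where "q = sinh u / D"
  have tanv: "tan (of_real A * z) = Complex p q"
    unfolding Az tan_diagonal D_def[symmetric] p_def q_def
    by (simp add: complex_eq_iff Re_divide_of_real Im_divide_of_real)
  have C: "C_approx N x = (q + p) / 2 + r * (a * sin \<sigma> - b * cos \<sigma>)"
    unfolding C_approx_def A_def[symmetric] u_def[symmetric] \<sigma>_def[symmetric] a_def[symmetric] b_def[symmetric]
      r_def[symmetric] D_def[symmetric] by (simp add: p_def q_def add_divide_distrib)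
  have S: "S_approx N x = (q - p) / 2 - r * (a * cos \<sigma> + b * sin \<sigma>)"
    unfolding S_approx_def A_def[symmetric] u_def[symmetric] \<sigma>_def[symmetric] a_def[symmetric] b_def[symmetric]
      r_def[symmetric] D_def[symmetric] by (simp add: p_def q_def diff_divide_distrib)
  have "(\<Sum>k=1..N. exp (z\<^sup>2 - (of_real (t_node N k))\<^sup>2) * (2 * z / ((of_real (t_node N k))\<^sup>2 - z\<^sup>2)) / A)
      = (2 * z / A) * cis \<sigma> * Complex b a"
    unfolding tm sum_distrib_left[symmetric] sumF by simp
  also have "\<dots> = (1 + \<i>) * of_real r * cis \<sigma> * Complex b a"
    unfolding zA ..
  finally show ?thesis
    unfolding A_def[symmetric] tanv C S
    by (simp add: complex_eq_iff field_simps)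
qed

section \<open>Size of the aliasing terms\<close>

text \<open>One integration by parts, written as the fundamental theorem for \<open>exp (- l s - s\<^sup>2 / 4)\<close>.\<close>

lemma gauss_laplace_by_parts:
  fixes l :: complex
  shows "set_integrable lborel {0<..} (\<lambda>s. of_real (s / 2) * exp (- l * of_real s - (of_real s)\<^sup>2 / 4))"
    and "(LBINT s:{0<..}. of_real (s / 2) * exp (- l * of_real s - (of_real s)\<^sup>2 / 4)) = 1 - l * gauss_laplace l"
proof -
  let ?e = "\<lambda>l s::real. exp (- l * of_real s - (of_real s)\<^sup>2 / 4) :: complex"
  show int: "set_integrable lborel {0<..} (\<lambda>s. of_real (s / 2) * ?e l s)"
  proof (rule set_integrable_bound[OF set_integrable_gauss_linear[of "{0<..}" "l - 1"]])
    show "set_borel_measurable lborel {0<..} (\<lambda>s. of_real (s / 2) * ?e l s)"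
      unfolding set_borel_measurable_def by measurable
    show "AE s in lborel. s \<in> {0<..} \<longrightarrow> norm (of_real (s / 2) * ?e l s) \<le> norm (?e (l - 1) s)"
    proof (intro AE_I2 impI)
      fix s :: real assume s: "s \<in> {0<..}"
      have "s / 2 \<le> exp s" using s exp_ge_add_one_self[of s] unfolding greaterThan_iff by linarith
      hence "\<bar>s / 2\<bar> \<le> exp s" using s by simp
      hence "\<bar>s / 2\<bar> * exp (- Re l * s - s\<^sup>2 / 4) \<le> exp s * exp (- Re l * s - s\<^sup>2 / 4)"
        by (intro mult_right_mono) auto
      also have "\<dots> = exp (- (Re l - 1) * s - s\<^sup>2 / 4)"
        by (simp add: algebra_simps flip: exp_add)
      finally show "norm (of_real (s / 2) * ?e l s) \<le> norm (?e (l - 1) s)"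
        by (simp add: norm_mult norm_exp_eq_Re power2_eq_square)
    qed
  qed simp
  have int2: "set_integrable lborel {0<..} (?e l)"
    by (rule set_integrable_gauss_linear) simp
  have d: "((\<lambda>s::real. - ?e l s) has_vector_derivative (l * ?e l s + of_real (s / 2) * ?e l s)) (at s)" for s
  proof -
    have "((\<lambda>w. - exp (- l * w - w\<^sup>2 / 4)) has_field_derivative (l * ?e l s + of_real (s / 2) * ?e l s)) (at (of_real s))"
      by (auto intro!: derivative_eq_intros simp: algebra_simps)
    thus ?thesis by (rule has_vector_derivative_real_field)
  qed
  have isum: "set_integrable lborel {0<..} (\<lambda>s. l * ?e l s + of_real (s / 2) * ?e l s)"
    by (intro set_integral_add int set_integrable_mult_right int2)
  have "(LBINT s=0..\<infinity>. l * ?e l s + of_real (s / 2) * ?e l s) = 0 - (- 1)"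
  proof (rule interval_integral_FTC_integrable[where F = "\<lambda>s. - ?e l s"])
    show "((\<lambda>s. - ?e l s) has_vector_derivative (l * ?e l s + of_real (s / 2) * ?e l s)) (at s)" for s
      by (rule d)
    show "isCont (\<lambda>s. l * ?e l s + of_real (s / 2) * ?e l s) s" for s
      by (intro continuous_intros) auto
    show "set_integrable lborel (einterval 0 \<infinity>) (\<lambda>s. l * ?e l s + of_real (s / 2) * ?e l s)"
      using isum by (simp add: einterval_def zero_ereal_def greaterThan_def)
    have "isCont (\<lambda>s. - ?e l s) 0" by (intro continuous_intros) auto
    hence "((\<lambda>s. - ?e l s) \<longlongrightarrow> - 1) (at_right 0)"
      by (simp add: isCont_def filterlim_at_split)
    thus "(((\<lambda>s. - ?e l s) \<circ> real_of_ereal) \<longlongrightarrow> - 1) (at_right 0)"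
      by (simp add: zero_ereal_def ereal_tendsto_simps)
    have "((\<lambda>s. norm (- ?e l s)) \<longlongrightarrow> 0) at_top"
    proof -
      have eq: "norm (- ?e l s) = exp (- ((Re l + 1/4 * s) * s))" for s
        by (simp add: norm_exp_eq_Re power2_eq_square algebra_simps)
      have "filterlim (\<lambda>s::real. (Re l + 1/4 * s) * s) at_top at_top"
        by (intro filterlim_at_top_mult_at_top filterlim_ident filterlim_tendsto_add_at_top[OF tendsto_const]
             filterlim_tendsto_pos_mult_at_top[OF tendsto_const]) auto
      hence "filterlim (\<lambda>s::real. - ((Re l + 1/4 * s) * s)) at_bot at_top"
        by (simp only: filterlim_uminus_at_bot minus_minus)
      thus ?thesis unfolding eq by (rule filterlim_compose[OF exp_at_bot])
    qed
    hence "((\<lambda>s. - ?e l s) \<longlongrightarrow> 0) at_top" by (rule tendsto_norm_zero_cancel)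
    thus "(((\<lambda>s. - ?e l s) \<circ> real_of_ereal) \<longlongrightarrow> 0) (at_left \<infinity>)"
      by (simp add: ereal_tendsto_simps)
  qed auto
  hence "(LBINT s:{0<..}. l * ?e l s + of_real (s / 2) * ?e l s) = 1"
    by (simp add: interval_integral_to_infinity_eq zero_ereal_def)
  also have "(LBINT s:{0<..}. l * ?e l s + of_real (s / 2) * ?e l s)
      = l * gauss_laplace l + (LBINT s:{0<..}. of_real (s / 2) * ?e l s)"
    unfolding gauss_laplace_def
    by (subst set_integral_add[OF set_integrable_mult_right[OF int2] int]) simp_all
  finally show "(LBINT s:{0<..}. of_real (s / 2) * ?e l s) = 1 - l * gauss_laplace l"
    by (simp add: algebra_simps)
qed

text \<open>The gain of a factor \<open>1 / norm l\<close>, rather than \<open>1 / Re l\<close>, uses the oscillation of the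
  integrand and stays effective when \<open>l\<close> approaches the imaginary axis.\<close>

lemma norm_gauss_laplace_le:
  assumes "Re l \<ge> 0" "l \<noteq> 0"
  shows "norm (gauss_laplace l) \<le> 2 / norm l"
proof -
  let ?e = "\<lambda>l s::real. exp (- l * of_real s - (of_real s)\<^sup>2 / 4) :: complex"
  have g: "set_integrable lborel {0<..} (\<lambda>s::real. s / 2 * exp (- (s\<^sup>2) / 4))"
      "(LBINT s:{0<..}. (s :: real) / 2 * exp (- (s\<^sup>2) / 4)) = 1"
  proof -
    have eq: "of_real (s / 2) * ?e 0 s = complex_of_real (s / 2 * exp (- (s\<^sup>2) / 4))" for s
      by (simp add: exp_of_real[symmetric])
    show "set_integrable lborel {0<..} (\<lambda>s::real. s / 2 * exp (- (s\<^sup>2) / 4))"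
      using gauss_laplace_by_parts(1)[of 0] unfolding eq by (simp only: complex_of_real_integrable_eq set_integrable_def of_real_mult[symmetric] scaleR_conv_of_real)
         (simp add: complex_of_real_integrable_eq flip: of_real_mult)
    have "complex_of_real (LBINT s:{0<..}. s / 2 * exp (- (s\<^sup>2) / 4)) = 1"
      using gauss_laplace_by_parts(2)[of 0] unfolding eq by (simp only: set_integral_complex_of_real) simp
    thus "(LBINT s:{0<..}. (s :: real) / 2 * exp (- (s\<^sup>2) / 4)) = 1" by (simp only: of_real_eq_1_iff)
  qed
  have "norm (LBINT s:{0<..}. of_real (s / 2) * ?e l s) \<le> (LBINT s:{0<..}. norm (of_real (s / 2) * ?e l s))"
    by (rule set_integral_norm_bound[OF gauss_laplace_by_parts(1)])
  also have "\<dots> \<le> (LBINT s:{0<..}. s / 2 * exp (- (s\<^sup>2) / 4))"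
  proof (rule set_integral_mono)
    show "set_integrable lborel {0<..} (\<lambda>s. norm (of_real (s / 2) * ?e l s))"
      by (rule set_integrable_norm[OF gauss_laplace_by_parts(1)])
    fix s :: real assume s: "s \<in> {0<..}"
    have "exp (- (Re l * s) - s\<^sup>2 / 4) \<le> exp (- (s\<^sup>2) / 4)" using assms s by simp
    hence "s / 2 * exp (- (Re l * s) - s\<^sup>2 / 4) \<le> s / 2 * exp (- (s\<^sup>2) / 4)"
      using s by (intro mult_left_mono) auto
    thus "norm (of_real (s / 2) * ?e l s) \<le> s / 2 * exp (- (s\<^sup>2) / 4)"
      using s by (simp add: norm_mult norm_exp_eq_Re power2_eq_square)
  qed (rule g(1))
  also have "\<dots> = 1" by (rule g(2))
  finally have n: "norm (1 - l * gauss_laplace l) \<le> 1" unfolding gauss_laplace_by_parts(2) .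
  have "norm (l * gauss_laplace l) = norm (1 - (1 - l * gauss_laplace l))" by simp
  also have "\<dots> \<le> 1 + norm (1 - l * gauss_laplace l)" by (metis norm_one norm_triangle_ineq4)
  finally have "norm l * norm (gauss_laplace l) \<le> 2" using n by (simp add: norm_mult)
  thus ?thesis using assms by (simp add: field_simps)
qed

text \<open>With \<open>u = n A\<close> the two arguments are \<open>u - b + \<i> b\<close> and \<open>u + b - \<i> b\<close>. For \<open>b \<le> u\<close> both have
  nonnegative real part, and neither has modulus below \<open>u / sqrt 2\<close>. For \<open>b > u\<close> the first one is
  reflected; the exponential that this produces has modulus \<open>exp (u\<^sup>2 - 2 u b) \<le> exp (- u\<^sup>2)\<close>,
  which the slack in the other two terms absorbs. Thus no distinction according to the distance of
  the pole from the contour is needed.\<close>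

lemma alias_term_bound:
  fixes A b :: real
  assumes A: "A > 0" and b: "b > 0" and n: "n \<ge> 1"
  shows "norm (alias_term A ((1 + \<i>) * of_real b) n) \<le> (2 * sqrt 2 + 2) / A * exp (- ((real n * A)\<^sup>2))"
proof -
  define u where "u = real n * A"
  have u: "u > 0" "A \<le> u" using A n by (simp_all add: u_def)
  let ?z = "(1 + \<i>) * complex_of_real b"
  have p: "of_real u + \<i> * ?z = Complex (u - b) b" and m: "of_real u - \<i> * ?z = Complex (u + b) (- b)"
    by (simp_all add: complex_eq_iff)
  have main: "norm (gauss_laplace (Complex (u - b) b)) + norm (gauss_laplace (Complex (u + b) (- b))) \<le> (2 * sqrt 2 + 2) / u"
  proof (cases "b \<le> u")
    case True
    have "u\<^sup>2 / 2 \<le> (u - b)\<^sup>2 + b\<^sup>2"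
      using zero_le_power2[of "u - 2 * b"] by (simp add: power2_eq_square algebra_simps)
    hence "sqrt (u\<^sup>2 / 2) \<le> norm (Complex (u - b) b)" unfolding cmod_def by simp
    hence l: "u / sqrt 2 \<le> norm (Complex (u - b) b)" using u by (simp add: real_sqrt_divide)
    have "norm (gauss_laplace (Complex (u - b) b)) \<le> 2 / norm (Complex (u - b) b)"
      using True b by (intro norm_gauss_laplace_le) (auto simp: complex_eq_iff)
    also have "\<dots> \<le> 2 / (u / sqrt 2)"
    proof -
      have "0 < u / sqrt 2" using u by simp
      thus ?thesis using l by (intro divide_left_mono mult_pos_pos) linarith+
    qed
    finally have 1: "norm (gauss_laplace (Complex (u - b) b)) \<le> 2 * sqrt 2 / u" by simp
    have l2: "u \<le> norm (Complex (u + b) (- b))"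
      using complex_Re_le_cmod[of "Complex (u + b) (- b)"] b by simp
    have "norm (gauss_laplace (Complex (u + b) (- b))) \<le> 2 / norm (Complex (u + b) (- b))"
      using u b by (intro norm_gauss_laplace_le) (auto simp: complex_eq_iff)
    also have "\<dots> \<le> 2 / u"
      using l2 u by (intro divide_left_mono mult_pos_pos) auto
    finally show ?thesis using 1 by (simp add: add_divide_distrib)
  next
    case False
    have l2: "2 * u \<le> norm (Complex (u + b) (- b))"
      using complex_Re_le_cmod[of "Complex (u + b) (- b)"] b False by simp
    have "norm (gauss_laplace (Complex (u + b) (- b))) \<le> 2 / norm (Complex (u + b) (- b))"
      using u b by (intro norm_gauss_laplace_le) (auto simp: complex_eq_iff)
    also have "\<dots> \<le> 2 / (2 * u)"
      using l2 u by (intro divide_left_mono mult_pos_pos) auto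
    finally have 1: "norm (gauss_laplace (Complex (u + b) (- b))) \<le> 1 / u" by simp
    have neg: "- Complex (u - b) b = Complex (b - u) (- b)" by (simp add: complex_eq_iff)
    have l3: "u \<le> norm (Complex (b - u) (- b))"
      using abs_Im_le_cmod[of "Complex (b - u) (- b)"] b False by simp
    have "norm (gauss_laplace (Complex (b - u) (- b))) \<le> 2 / norm (Complex (b - u) (- b))"
      using False b by (intro norm_gauss_laplace_le) (auto simp: complex_eq_iff)
    also have "\<dots> \<le> 2 / u"
      using l3 u by (intro divide_left_mono mult_pos_pos) auto
    finally have 2: "norm (gauss_laplace (Complex (b - u) (- b))) \<le> 2 / u" .
    have "norm (exp ((Complex (u - b) b)\<^sup>2)) \<le> exp (- (u\<^sup>2))"
    proof -
      have "(u - b) * (u - b) - b * b = u * u - 2 * (u * b)" by (simp add: algebra_simps)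
      moreover have "u * u \<le> u * b" using False u by (intro mult_left_mono) auto
      ultimately show ?thesis by (simp add: norm_exp_eq_Re power2_eq_square)
    qed
    also have "exp (- (u\<^sup>2)) \<le> 1 / (2 * u)"
    proof -
      have "2 * u \<le> 1 + u\<^sup>2" using zero_le_power2[of "u - 1"] by (simp add: power2_eq_square algebra_simps)
      also have "\<dots> \<le> exp (u\<^sup>2)" by (rule exp_ge_add_one_self)
      finally show ?thesis using u by (simp add: exp_minus field_simps)
    qed
    finally have 3: "norm (exp ((Complex (u - b) b)\<^sup>2)) \<le> 1 / (2 * u)" .
    have "gauss_laplace (Complex (u - b) b) = 2 * sqrt pi * exp ((Complex (u - b) b)\<^sup>2) - gauss_laplace (Complex (b - u) (- b))"
      using gauss_laplace_reflection[of "Complex (u - b) b"] unfolding neg by (simp add: algebra_simps)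
    hence "norm (gauss_laplace (Complex (u - b) b)) \<le> norm (2 * sqrt pi * exp ((Complex (u - b) b)\<^sup>2)) + norm (gauss_laplace (Complex (b - u) (- b)))"
      by (simp only: norm_triangle_ineq4)
    also have "norm (2 * sqrt pi * exp ((Complex (u - b) b)\<^sup>2)) = 2 * sqrt pi * norm (exp ((Complex (u - b) b)\<^sup>2))"
      by (simp add: norm_mult)
    also have "\<dots> \<le> 2 * sqrt pi * (1 / (2 * u))"
      by (intro mult_left_mono 3) auto
    finally have "norm (gauss_laplace (Complex (u - b) b)) \<le> sqrt pi / u + 2 / u"
      using 2 by simp
    hence "norm (gauss_laplace (Complex (u - b) b)) + norm (gauss_laplace (Complex (u + b) (- b))) \<le> (sqrt pi + 3) / u"
      using 1 by (simp add: add_divide_distrib)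
    also have "sqrt pi + 3 \<le> 2 * sqrt 2 + 2"
    proof -
      have "sqrt pi \<le> 1.8" using pi_approx by (intro real_le_lsqrt) (auto simp: power2_eq_square)
      moreover have "sqrt 2 \<ge> 1.4" by (intro real_le_rsqrt) (auto simp: power2_eq_square)
      ultimately show ?thesis by simp
    qed
    hence "(sqrt pi + 3) / u \<le> (2 * sqrt 2 + 2) / u" using u by (intro divide_right_mono) auto
    finally show ?thesis .
  qed
  have "norm (alias_term A ?z n) = exp (- (u\<^sup>2)) * norm (gauss_laplace (Complex (u - b) b) - gauss_laplace (Complex (u + b) (- b)))"
    unfolding alias_term_def u_def[symmetric] p m by (simp add: norm_mult norm_exp_eq_Re power2_eq_square)
  also have "\<dots> \<le> exp (- (u\<^sup>2)) * (norm (gauss_laplace (Complex (u - b) b)) + norm (gauss_laplace (Complex (u + b) (- b))))"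
    by (intro mult_left_mono norm_triangle_ineq4) auto
  also have "\<dots> \<le> exp (- (u\<^sup>2)) * ((2 * sqrt 2 + 2) / A)"
  proof (intro mult_left_mono order.trans[OF main])
    show "(2 * sqrt 2 + 2) / u \<le> (2 * sqrt 2 + 2) / A"
      using u A by (intro divide_left_mono mult_pos_pos add_nonneg_nonneg) auto
  qed auto
  finally show ?thesis by (simp add: u_def mult.commute)
qed

text \<open>Both sides are compared with \<open>\<bar>y\<bar>\<close>.\<close>

lemma abs_sin_le_abs_sinh: "\<bar>sin y\<bar> \<le> \<bar>sinh y\<bar>" for y :: real
proof -
  have *: "y \<le> sinh y" if "y \<ge> 0" for y :: real
  proof -
    have "sinh 0 - 0 \<le> sinh y - y"
    proof (rule DERIV_nonneg_imp_nondecreasing[OF that])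
      fix x :: real
      show "\<exists>D. ((\<lambda>x. sinh x - x) has_real_derivative D) (at x) \<and> 0 \<le> D"
        by (rule exI[of _ "cosh x - 1"]) (auto intro!: derivative_eq_intros simp: cosh_real_ge_1)
    qed
    thus ?thesis by simp
  qed
  have "\<bar>sin y\<bar> \<le> \<bar>y\<bar>" by (rule abs_sin_x_le_abs_x)
  also have "\<bar>y\<bar> \<le> \<bar>sinh y\<bar>"
    using *[of y] *[of "- y"] by (cases "y \<ge> 0") auto
  finally show ?thesis .
qed

text \<open>The difference of the two transforms is the Laplace transform of \<open>sin (z s)\<close> times a Gaussian.
  On the diagonal \<open>norm (sin (z s)) \<le> sqrt 2 * sinh (b s)\<close>, whose transform is elementary; dropping
  the Gaussian, the factor \<open>4 / 3\<close> is the value of \<open>1 / (1 - (b / u)\<^sup>2)\<close> at \<open>b = u / 2\<close>. The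
  bound is proportional to \<open>b\<close>, hence to the argument of the Fresnel integral.\<close>

lemma alias_term_bound_small:
  fixes A b :: real
  assumes A: "A > 0" and b: "b > 0" "b \<le> A / 2" and n: "n \<ge> 1"
  shows "norm (alias_term A ((1 + \<i>) * of_real b) n) \<le> 8 * sqrt 2 * b / (3 * A\<^sup>2) * exp (- ((real n * A)\<^sup>2))"
proof -
  define u where "u = real n * A"
  have u: "u > 0" "A \<le> u" using A n by (simp_all add: u_def)
  have ub: "b < u" using b u A by simp
  let ?z = "(1 + \<i>) * complex_of_real b"
  let ?d = "\<lambda>s::real. exp (- (of_real u + \<i> * ?z) * of_real s - (of_real s)\<^sup>2 / 4) - exp (- (of_real u - \<i> * ?z) * of_real s - (of_real s)\<^sup>2 / 4)"
  let ?g = "\<lambda>s::real. sqrt 2 * (exp (- (u - b) * s) - exp (- (u + b) * s))"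
  have e1: "set_integrable lborel {0<..} (\<lambda>s. exp (- (u - b) * s))" "(LBINT s:{0<..}. exp (- (u - b) * s)) = 1 / (u - b)"
    using integral_exp_half_line(3,4)[of "of_real (- (u - b))"] ub by (simp_all add: minus_divide_right)
  have e2: "set_integrable lborel {0<..} (\<lambda>s. exp (- (u + b) * s))" "(LBINT s:{0<..}. exp (- (u + b) * s)) = 1 / (u + b)"
    using integral_exp_half_line(3,4)[of "of_real (- (u + b))"] u b by (simp_all add: minus_divide_right)
  have gi: "set_integrable lborel {0<..} ?g"
    by (intro set_integrable_mult_right set_integral_diff e1 e2)
  have g: "(LBINT s:{0<..}. ?g s) = sqrt 2 * (1 / (u - b) - 1 / (u + b))"
    by (simp only: set_integral_mult_right set_integral_diff(2)[OF e1(1) e2(1)] e1(2) e2(2))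
  have di: "set_integrable lborel {0<..} ?d"
    by (intro set_integral_diff set_integrable_gauss_linear) auto
  have "gauss_laplace (of_real u + \<i> * ?z) - gauss_laplace (of_real u - \<i> * ?z) = (LBINT s:{0<..}. ?d s)"
    unfolding gauss_laplace_def by (intro set_integral_diff(2)[symmetric] set_integrable_gauss_linear) auto
  hence "norm (gauss_laplace (of_real u + \<i> * ?z) - gauss_laplace (of_real u - \<i> * ?z)) \<le> (LBINT s:{0<..}. norm (?d s))"
    using set_integral_norm_bound[OF di] by simp
  also have "\<dots> \<le> (LBINT s:{0<..}. ?g s)"
  proof (rule set_integral_mono[OF set_integrable_norm[OF di] gi])
    fix s :: real assume s: "s \<in> {0<..}"
    have f: "?d s = exp (of_real (- u * s - s\<^sup>2 / 4)) * (- 2 * \<i> * sin (?z * of_real s))"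
    proof -
      have sn: "- 2 * \<i> * sin (?z * of_real s) = exp (- (\<i> * (?z * of_real s))) - exp (\<i> * (?z * of_real s))"
        unfolding sin_exp_eq by (simp add: field_simps)
      have e: "exp (- (of_real u + \<i> * ?z) * of_real s - (of_real s)\<^sup>2 / 4) = exp (of_real (- u * s - s\<^sup>2 / 4)) * exp (- (\<i> * (?z * of_real s)))"
           "exp (- (of_real u - \<i> * ?z) * of_real s - (of_real s)\<^sup>2 / 4) = exp (of_real (- u * s - s\<^sup>2 / 4)) * exp (\<i> * (?z * of_real s))"
        unfolding exp_add[symmetric] by (rule arg_cong[where f = exp], simp add: algebra_simps)+
      show ?thesis unfolding sn e right_diff_distrib ..
    qed
    have "(norm (sin (?z * of_real s)))\<^sup>2 = (sin (b * s))\<^sup>2 + (sinh (b * s))\<^sup>2"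
    proof -
      have "(norm (sin (?z * of_real s)))\<^sup>2 = (sin (b * s))\<^sup>2 * (cosh (b * s))\<^sup>2 + (cos (b * s))\<^sup>2 * (sinh (b * s))\<^sup>2"
        by (simp add: cmod_power2 Re_sin Im_sin cosh_def sinh_def power_mult_distrib power_divide)
      also have "\<dots> = (sin (b * s))\<^sup>2 + ((sin (b * s))\<^sup>2 + (cos (b * s))\<^sup>2) * (sinh (b * s))\<^sup>2"
        unfolding cosh_square_eq by (simp only: ring_distribs mult_1_right mult_1_left ac_simps)
      finally show ?thesis by (simp only: sin_cos_squared_add mult_1)
    qed
    also have "\<dots> \<le> 2 * (sinh (b * s))\<^sup>2"
      using abs_sin_le_abs_sinh[of "b * s"] by (simp add: abs_le_square_iff)
    also have "\<dots> = (sqrt 2 * sinh (b * s))\<^sup>2" by (simp add: power_mult_distrib)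
    finally have sn: "norm (sin (?z * of_real s)) \<le> sqrt 2 * sinh (b * s)"
      by (rule power2_le_imp_le) (use s b in simp)
    have "norm (?d s) = exp (- u * s - s\<^sup>2 / 4) * (2 * norm (sin (?z * of_real s)))"
      unfolding f by (simp add: norm_mult norm_exp_eq_Re)
    also have "\<dots> \<le> exp (- u * s) * (2 * (sqrt 2 * sinh (b * s)))"
      using sn by (intro mult_mono) auto
    also have "\<dots> = ?g s"
      by (simp add: sinh_def algebra_simps flip: exp_add)
    finally show "norm (?d s) \<le> ?g s" .
  qed
  also have "\<dots> = 2 * sqrt 2 * b / (u\<^sup>2 - b\<^sup>2)"
  proof -
    have "1 / (u - b) - 1 / (u + b) = 2 * b / ((u - b) * (u + b))"
      using ub u b by (subst diff_frac_eq) auto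
    moreover have "(u - b) * (u + b) = u\<^sup>2 - b\<^sup>2" by (simp add: power2_eq_square algebra_simps)
    ultimately show ?thesis unfolding g by simp
  qed
  also have "\<dots> \<le> 2 * sqrt 2 * b / (3 / 4 * A\<^sup>2)"
  proof (rule divide_left_mono)
    have "b\<^sup>2 \<le> (A / 2)\<^sup>2" "A\<^sup>2 \<le> u\<^sup>2" using b u A by (intro power_mono; simp)+
    thus le: "3 / 4 * A\<^sup>2 \<le> u\<^sup>2 - b\<^sup>2" by (simp add: power_divide)
    have "0 < 3 / 4 * A\<^sup>2" using A by simp
    moreover have "0 < u\<^sup>2 - b\<^sup>2" using le \<open>0 < 3 / 4 * A\<^sup>2\<close> by linarith
    ultimately show "0 < (u\<^sup>2 - b\<^sup>2) * (3 / 4 * A\<^sup>2)" by (simp only: mult_pos_pos)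
  qed (use b in simp)
  also have "\<dots> = 8 * sqrt 2 * b / (3 * A\<^sup>2)" by simp
  finally have main: "norm (gauss_laplace (of_real u + \<i> * ?z) - gauss_laplace (of_real u - \<i> * ?z)) \<le> 8 * sqrt 2 * b / (3 * A\<^sup>2)" .
  have "norm (alias_term A ?z n) = exp (- (u\<^sup>2)) * norm (gauss_laplace (of_real u + \<i> * ?z) - gauss_laplace (of_real u - \<i> * ?z))"
    unfolding alias_term_def u_def[symmetric] by (simp add: norm_mult norm_exp_eq_Re power2_eq_square)
  also have "\<dots> \<le> exp (- (u\<^sup>2)) * (8 * sqrt 2 * b / (3 * A\<^sup>2))"
    by (intro mult_left_mono main) auto
  finally show ?thesis by (simp add: u_def mult.commute)
qed

section \<open>The constants\<close>

lemma A_rt_sq: "(A_rt N)\<^sup>2 = (real N + 1/2) * pi"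
  by (simp add: A_rt_def)

lemma A_rt_pos: "0 < A_rt N"
  by (simp add: A_rt_def)

lemma A_rt_strict_mono: "M < N \<Longrightarrow> A_rt M < A_rt N"
  by (simp add: A_rt_def)

lemma pi_powr_three_halves: "pi powr (3/2) = pi * sqrt pi"
proof -
  have "pi powr (3/2) = pi powr (1 + 1/2)" by simp
  also have "\<dots> = pi * sqrt pi" unfolding powr_add by (simp add: powr_half_sqrt)
  finally show ?thesis .
qed

lemma beta_val_lower: "beta_val \<ge> 0.0536"
proof -
  have "sqrt 2 \<le> 1.41422" by (intro real_le_lsqrt) (auto simp: power2_eq_square)
  thus ?thesis by (simp add: beta_val_def field_simps)
qed

lemma one_minus_exp_pos: "0 < 1 - exp (- 2 * (A_rt N)\<^sup>2)"
  using A_rt_pos[of N] by simp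

lemma one_minus_exp_mono:
  assumes "M < N"
  shows "1 - exp (- 2 * (A_rt M)\<^sup>2) \<le> 1 - exp (- 2 * (A_rt N)\<^sup>2)"
  using A_rt_strict_mono[OF assms] A_rt_pos[of M] by (simp add: power_mono)

lemma c_bd_pos: "0 < c_bd N"
  unfolding c_bd_def using A_rt_pos[of N] one_minus_exp_pos[of N]
  by (intro add_pos_pos mult_pos_pos divide_pos_pos) (auto intro!: add_pos_nonneg)

lemma c_tilde_bd_pos: "0 < c_tilde_bd N"
  unfolding c_tilde_bd_def using A_rt_pos[of N] one_minus_exp_pos[of N]
  by (intro add_pos_pos mult_pos_pos divide_pos_pos) (auto intro!: add_pos_nonneg)

lemma c_bd_strict_antimono:
  assumes "M < N"
  shows "c_bd N < c_bd M"
proof -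
  note A = A_rt_strict_mono[OF assms] A_rt_pos[of M]
  have A2: "(A_rt M)\<^sup>2 \<le> (A_rt N)\<^sup>2" using A by (intro power_mono) auto
  have "20 * sqrt 2 * exp (- pi / 2) / (9 * pi * (1 - exp (- 2 * (A_rt N)\<^sup>2))) * (1 + 2 * sqrt pi * exp (- beta_val * (A_rt N)\<^sup>2))
      \<le> 20 * sqrt 2 * exp (- pi / 2) / (9 * pi * (1 - exp (- 2 * (A_rt M)\<^sup>2))) * (1 + 2 * sqrt pi * exp (- beta_val * (A_rt M)\<^sup>2))"
  proof (rule mult_mono)
    show "20 * sqrt 2 * exp (- pi / 2) / (9 * pi * (1 - exp (- 2 * (A_rt N)\<^sup>2))) \<le> 20 * sqrt 2 * exp (- pi / 2) / (9 * pi * (1 - exp (- 2 * (A_rt M)\<^sup>2)))"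
      using one_minus_exp_mono[OF assms] one_minus_exp_pos[of M] one_minus_exp_pos[of N]
      by (intro divide_left_mono mult_left_mono mult_pos_pos) auto
    have "beta_val * (A_rt M)\<^sup>2 \<le> beta_val * (A_rt N)\<^sup>2"
      using beta_val_lower A2 by (intro mult_left_mono) auto
    thus "1 + 2 * sqrt pi * exp (- beta_val * (A_rt N)\<^sup>2) \<le> 1 + 2 * sqrt pi * exp (- beta_val * (A_rt M)\<^sup>2)"
      by simp
    show "0 \<le> 1 + 2 * sqrt pi * exp (- beta_val * (A_rt N)\<^sup>2)" by simp
    show "0 \<le> 20 * sqrt 2 * exp (- pi / 2) / (9 * pi * (1 - exp (- 2 * (A_rt M)\<^sup>2)))"
      using one_minus_exp_pos[of M] by (intro divide_nonneg_pos mult_pos_pos) auto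
  qed
  moreover have "(2 * pi + 1) * exp (- pi / 2) / (2 * sqrt 2 * pi powr (3/2) * A_rt N)
       < (2 * pi + 1) * exp (- pi / 2) / (2 * sqrt 2 * pi powr (3/2) * A_rt M)"
    using A by (intro divide_strict_left_mono mult_strict_left_mono mult_pos_pos) (auto intro: add_pos_pos)
  ultimately show ?thesis unfolding c_bd_def by (rule add_le_less_mono)
qed

lemma c_tilde_bd_strict_antimono:
  assumes "M < N"
  shows "c_tilde_bd N < c_tilde_bd M"
proof -
  note A = A_rt_strict_mono[OF assms] A_rt_pos[of M]
  have "8 / (3 * pi powr (3/2) * exp (pi / 2) * (1 - exp (- 2 * (A_rt N)\<^sup>2))) \<le> 8 / (3 * pi powr (3/2) * exp (pi / 2) * (1 - exp (- 2 * (A_rt M)\<^sup>2)))"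
    using one_minus_exp_mono[OF assms] one_minus_exp_pos[of M] one_minus_exp_pos[of N]
    by (intro divide_left_mono mult_left_mono mult_pos_pos) auto
  moreover have "(2 * pi + 1) / (pi\<^sup>2 * exp (pi / 2) * A_rt N) < (2 * pi + 1) / (pi\<^sup>2 * exp (pi / 2) * A_rt M)"
    using A by (intro divide_strict_left_mono mult_strict_left_mono mult_pos_pos) (auto intro: add_pos_pos)
  ultimately show ?thesis unfolding c_tilde_bd_def by (rule add_le_less_mono)
qed

text \<open>Lower bounds for the exponential at positive rational points yield the decimal upper bounds
  below.\<close>

lemma exp_ge_partial_sum:
  fixes x :: real
  assumes "x \<ge> 0"
  shows "(\<Sum>k<n. x ^ k / fact k) \<le> exp x"
proof -
  have "(\<Sum>k<n. inverse (fact k) * x ^ k) \<le> (\<Sum>k. inverse (fact k) * x ^ k)"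
    using assms summable_exp[of x] by (intro sum_le_suminf) auto
  also have "\<dots> = exp x" by (simp add: exp_def scaleR_conv_of_real)
  finally show ?thesis by (simp add: field_simps)
qed

lemma exp_neg_half_pi_upper: "exp (- pi / 2) \<le> 0.208"
proof -
  \<comment> \<open>\<open>1.5707 < \<pi> / 2\<close>, and nine terms suffice to exceed \<open>1 / 0.208\<close>.\<close>
  have "4.808 \<le> (\<Sum>k<9. (1.5707::real) ^ k / fact k)"
    by (simp add: eval_nat_numeral)
  also have "\<dots> \<le> exp 1.5707" by (rule exp_ge_partial_sum) simp
  also have "\<dots> \<le> exp (pi / 2)" using pi_approx by simp
  finally have "4.808 \<le> exp (pi / 2)" .
  hence "1 / exp (pi / 2) \<le> 1 / 4.808" by (intro divide_left_mono) auto
  thus ?thesis by (simp add: exp_minus inverse_eq_divide)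
qed

lemma exp_beta_upper: "exp (- beta_val * (A_rt 1)\<^sup>2) \<le> 0.7775"
proof -
  have "1.2863 \<le> (\<Sum>k<4. (0.252::real) ^ k / fact k)"
    by (simp add: eval_nat_numeral)
  also have "\<dots> \<le> exp 0.252" by (rule exp_ge_partial_sum) simp
  also have "\<dots> \<le> exp (beta_val * (A_rt 1)\<^sup>2)"
  proof -
    have "0.252 \<le> 0.0536 * (3/2 * (3.1415::real))" by simp
    also have "\<dots> \<le> beta_val * (A_rt 1)\<^sup>2"
      unfolding A_rt_sq using beta_val_lower pi_approx by (intro mult_mono) auto
    finally show ?thesis by simp
  qed
  finally have "1.2863 \<le> exp (beta_val * (A_rt 1)\<^sup>2)" .
  hence "1 / exp (beta_val * (A_rt 1)\<^sup>2) \<le> 1 / 1.2863" by (intro divide_left_mono) auto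
  thus ?thesis by (simp add: exp_minus inverse_eq_divide)
qed

lemma one_minus_exp_lower: "0.9999 \<le> 1 - exp (- 2 * (A_rt 1)\<^sup>2)"
proof -
  have "exp (- 2 * (A_rt 1)\<^sup>2) = exp (- pi / 2) ^ 6"
    unfolding A_rt_sq by (simp flip: exp_of_nat_mult)
  also have "\<dots> \<le> 0.208 ^ 6" by (intro power_mono exp_neg_half_pi_upper) auto
  also have "(0.208 :: real) ^ 6 \<le> 0.0001" by (simp add: eval_nat_numeral)
  finally show ?thesis by simp
qed

lemma numeric_bounds:
  shows "1.7724 \<le> sqrt pi" "sqrt pi \<le> 1.7725" "sqrt 2 \<le> 1.41422" "1.414 \<le> sqrt 2" "2.17 \<le> A_rt 1"
    "3.1415 \<le> pi" "pi \<le> 3.1416"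
proof -
  show "3.1415 \<le> pi" "pi \<le> 3.1416" using pi_approx by simp_all
  note p = this
  show "1.7724 \<le> sqrt pi" by (rule real_le_rsqrt) (use p in \<open>simp add: power2_eq_square\<close>)
  show "sqrt pi \<le> 1.7725" by (rule real_le_lsqrt) (use p in \<open>simp_all add: power2_eq_square\<close>)
  show "2.17 \<le> A_rt 1" unfolding A_rt_def by (rule real_le_rsqrt) (use p in \<open>simp add: power2_eq_square\<close>)
  show "sqrt 2 \<le> 1.41422" by (rule real_le_lsqrt) (simp_all add: power2_eq_square)
  show "1.414 \<le> sqrt 2" by (rule real_le_rsqrt) (simp add: power2_eq_square)
qed

lemma c_bd_one: "c_bd 1 < 0.83"
proof -
  note nb = numeric_bounds exp_neg_half_pi_upper exp_beta_upper one_minus_exp_lower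
  have "20 * sqrt 2 * exp (- pi / 2) / (9 * pi * (1 - exp (- 2 * (A_rt 1)\<^sup>2))) * (1 + 2 * sqrt pi * exp (- beta_val * (A_rt 1)\<^sup>2))
     \<le> 20 * 1.41422 * 0.208 / (9 * 3.1415 * 0.9999) * (1 + 2 * 1.7725 * 0.7775)"
    using nb by (intro mult_mono frac_le add_mono order_refl mult_pos_pos) auto
  moreover have "(2 * pi + 1) * exp (- pi / 2) / (2 * sqrt 2 * pi powr (3/2) * A_rt 1)
     \<le> (2 * 3.1416 + 1) * 0.208 / (2 * 1.414 * (3.1415 * 1.7724) * 2.17)"
    unfolding pi_powr_three_halves
    using nb by (intro mult_mono frac_le add_mono order_refl mult_pos_pos) auto
  ultimately have "c_bd 1 \<le> 20 * 1.41422 * 0.208 / (9 * 3.1415 * 0.9999) * (1 + 2 * 1.7725 * 0.7775)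
      + (2 * 3.1416 + 1) * 0.208 / (2 * 1.414 * (3.1415 * 1.7724) * 2.17)"
    unfolding c_bd_def by (rule add_mono)
  also have "\<dots> < 0.83" by simp
  finally show ?thesis .
qed

lemma c_tilde_bd_one: "c_tilde_bd 1 < 0.18"
proof -
  note nb = numeric_bounds one_minus_exp_lower
  have e: "4.8 \<le> exp (pi / 2)"
  proof -
    have "1 / exp (pi / 2) \<le> 0.208" using exp_neg_half_pi_upper by (simp add: exp_minus inverse_eq_divide)
    thus ?thesis by (simp add: field_simps)
  qed
  have "8 / (3 * pi powr (3/2) * exp (pi / 2) * (1 - exp (- 2 * (A_rt 1)\<^sup>2)))
     \<le> 8 / (3 * (3.1415 * 1.7724) * 4.8 * 0.9999)"
    unfolding pi_powr_three_halves
    using nb e by (intro mult_mono frac_le add_mono order_refl mult_pos_pos) auto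
  moreover have "(2 * pi + 1) / (pi\<^sup>2 * exp (pi / 2) * A_rt 1) \<le> (2 * 3.1416 + 1) / (3.1415\<^sup>2 * 4.8 * 2.17)"
    using nb e by (intro mult_mono frac_le add_mono power_mono order_refl mult_pos_pos) auto
  ultimately have "c_tilde_bd 1 \<le> 8 / (3 * (3.1415 * 1.7724) * 4.8 * 0.9999) + (2 * 3.1416 + 1) / (3.1415\<^sup>2 * 4.8 * 2.17)"
    unfolding c_tilde_bd_def by (rule add_mono)
  also have "\<dots> < 0.18" by (simp add: power2_eq_square)
  finally show ?thesis .
qed

section \<open>Error estimates\<close>

text \<open>Since \<open>(n + 1)\<^sup>2 \<ge> 1 + 2 n\<close>, the terms decrease at least geometrically.\<close>

lemma alias_series_bound:
  fixes A c :: real and z T :: complex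
  assumes T: "(\<lambda>n. (-1) ^ Suc n * alias_term A z (Suc n)) sums T"
    and A: "A > 0" and c: "c \<ge> 0"
    and bd: "\<And>n. n \<ge> 1 \<Longrightarrow> norm (alias_term A z n) \<le> c * exp (- ((real n * A)\<^sup>2))"
  shows "norm T \<le> c * exp (- (A\<^sup>2)) / (1 - exp (- 2 * A\<^sup>2))"
proof -
  define r where "r = exp (- 2 * A\<^sup>2)"
  have r: "0 \<le> r" "r < 1" using A by (simp_all add: r_def)
  have G: "(\<lambda>n. c * exp (- (A\<^sup>2)) * r ^ n) sums (c * exp (- (A\<^sup>2)) * (1 / (1 - r)))"
    using r by (intro sums_mult geometric_sums) auto
  have "norm T \<le> c * exp (- (A\<^sup>2)) * (1 / (1 - r))"
  proof (rule norm_sums_le[OF T G])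
    fix n :: nat
    have "norm ((-1) ^ Suc n * alias_term A z (Suc n)) = norm (alias_term A z (Suc n))"
      by (simp add: norm_mult norm_power)
    also have "\<dots> \<le> c * exp (- ((real (Suc n) * A)\<^sup>2))" by (intro bd) simp
    also have "\<dots> \<le> c * (exp (- (A\<^sup>2)) * r ^ n)"
    proof (intro mult_left_mono c)
      have "exp (- (A\<^sup>2)) * r ^ n = exp (- (A\<^sup>2) + real n * (- 2 * A\<^sup>2))"
        unfolding r_def exp_add exp_of_nat_mult ..
      moreover have "- ((real (Suc n) * A)\<^sup>2) \<le> - (A\<^sup>2) + real n * (- 2 * A\<^sup>2)"
      proof -
        have "(real (Suc n) * A)\<^sup>2 = A\<^sup>2 + real n * (2 * A\<^sup>2) + (real n * A)\<^sup>2"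
          by (simp add: power2_eq_square algebra_simps)
        thus ?thesis by simp
      qed
      ultimately show "exp (- ((real (Suc n) * A)\<^sup>2)) \<le> exp (- (A\<^sup>2)) * r ^ n" by simp
    qed
    finally show "norm ((-1) ^ Suc n * alias_term A z (Suc n)) \<le> c * exp (- (A\<^sup>2)) * r ^ n"
      by (simp add: mult.assoc)
  qed
  thus ?thesis by (simp add: r_def)
qed

lemma t_node_eq: "t_node N k = (real k - 1/2) * pi / A_rt N"
  by (simp add: t_node_def A_rt_def)

text \<open>The choice \<open>A\<^sup>2 = (N + 1/2) \<pi>\<close> puts the first discarded node exactly at \<open>A\<close>, which balances
  the truncation error against the aliasing error.\<close>

lemma t_node_beyond: "t_node N (Suc N + j) = A_rt N + real j * pi / A_rt N"
proof -
  have "t_node N (Suc N + j) = ((real N + 1/2) * pi + real j * pi) / A_rt N"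
    by (simp add: t_node_eq algebra_simps)
  also have "\<dots> = (A_rt N)\<^sup>2 / A_rt N + real j * pi / A_rt N"
    by (simp add: A_rt_sq add_divide_distrib)
  finally show ?thesis using A_rt_pos[of N] by (simp add: power2_eq_square)
qed

lemma A_rt_le_t_node:
  assumes "k > N"
  shows "A_rt N \<le> t_node N k"
proof -
  obtain j where "k = Suc N + j" using assms less_iff_Suc_add by auto
  thus ?thesis using A_rt_pos[of N] unfolding \<open>k = _\<close> t_node_beyond by simp
qed

text \<open>Beyond \<open>A\<close> the squares of the nodes grow by at least \<open>2 \<pi>\<close> per step, and
  \<open>1 / (1 - exp (- 2 \<pi>)) \<le> (2 \<pi> + 1) / (2 \<pi>)\<close> follows from \<open>exp y \<ge> 1 + y\<close>.\<close>

lemma node_tail_bound: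
  "(\<Sum>k=Suc N..M. exp (- ((t_node N k)\<^sup>2))) \<le> exp (- ((A_rt N)\<^sup>2)) * ((2 * pi + 1) / (2 * pi))"
proof -
  define A where "A = A_rt N"
  define r where "r = exp (- 2 * pi)"
  have A: "A > 0" by (simp add: A_def A_rt_pos)
  have r: "0 \<le> r" "r < 1" by (simp_all add: r_def)
  have "(\<Sum>k=Suc N..M. exp (- ((t_node N k)\<^sup>2))) = (\<Sum>j<M - N. exp (- ((t_node N (Suc N + j))\<^sup>2)))"
    by (rule sum.reindex_bij_witness[of _ "\<lambda>j. Suc N + j" "\<lambda>k. k - Suc N"]) auto
  also have "\<dots> \<le> (\<Sum>j<M - N. exp (- (A\<^sup>2)) * r ^ j)"
  proof (rule sum_mono)
    fix j
    have "(A + real j * pi / A)\<^sup>2 = A\<^sup>2 + real j * (2 * pi) + (real j * pi / A)\<^sup>2"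
      using A by (simp add: power2_sum)
    hence "- ((t_node N (Suc N + j))\<^sup>2) \<le> - (A\<^sup>2) + real j * (- 2 * pi)"
      unfolding t_node_beyond A_def[symmetric] by simp
    moreover have "exp (- (A\<^sup>2)) * r ^ j = exp (- (A\<^sup>2) + real j * (- 2 * pi))"
      unfolding r_def exp_add exp_of_nat_mult ..
    ultimately show "exp (- ((t_node N (Suc N + j))\<^sup>2)) \<le> exp (- (A\<^sup>2)) * r ^ j" by simp
  qed
  also have "\<dots> = exp (- (A\<^sup>2)) * (\<Sum>j<M - N. r ^ j)" by (simp add: sum_distrib_left)
  also have "\<dots> \<le> exp (- (A\<^sup>2)) * ((2 * pi + 1) / (2 * pi))"
  proof (rule mult_left_mono)
    have "(\<Sum>j<M - N. r ^ j) \<le> (\<Sum>j. r ^ j)"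
      using r by (intro sum_le_suminf summable_geometric) auto
    also have "\<dots> = 1 / (1 - r)" using r by (simp add: suminf_geometric)
    also have "\<dots> \<le> (2 * pi + 1) / (2 * pi)"
    proof -
      have "1 + 2 * pi \<le> exp (2 * pi)" by (rule exp_ge_add_one_self)
      moreover have "r * exp (2 * pi) = 1" by (simp add: r_def flip: exp_add)
      ultimately have "r * (1 + 2 * pi) \<le> 1" using r by (metis mult_left_mono)
      thus ?thesis using r by (simp add: field_simps)
    qed
    finally show "(\<Sum>j<M - N. r ^ j) \<le> (2 * pi + 1) / (2 * pi)" .
  qed simp
  finally show ?thesis by (simp add: A_def)
qed

text \<open>The error splits into the aliasing series and the discarded nodes. Both estimates of the
  theorem are instances, with different bounds \<open>c\<close> and \<open>q\<close>.\<close>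

lemma approximation_error:
  fixes x c q :: real and N :: nat
  defines "z \<equiv> (1 + \<i>) * of_real (sqrt pi * x / 2)"
  assumes x: "x > 0" and c: "c \<ge> 0" and q: "q \<ge> 0"
    and aliasing: "\<And>n. n \<ge> 1 \<Longrightarrow> norm (alias_term (A_rt N) z n) \<le> c * exp (- ((real n * A_rt N)\<^sup>2))"
    and node: "\<And>k. k > N \<Longrightarrow> norm (2 * z / ((of_real (t_node N k))\<^sup>2 - z\<^sup>2)) \<le> q"
  shows "sqrt 2 * norm (Complex (fresnel_C x) (fresnel_S x) - Complex (C_approx N x) (S_approx N x))
     \<le> c / sqrt pi * exp (- ((A_rt N)\<^sup>2)) / (1 - exp (- 2 * (A_rt N)\<^sup>2))
       + q / A_rt N * exp (- ((A_rt N)\<^sup>2)) * ((2 * pi + 1) / (2 * pi))"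
proof -
  define A where "A = A_rt N"
  have A: "A > 0" by (simp add: A_def A_rt_pos)
  define W where "W = Complex (fresnel_C x) (fresnel_S x)"
  define Z where "Z = Complex (C_approx N x) (S_approx N x)"
  define g where "g = (\<lambda>k. exp (z\<^sup>2 - (of_real (t_node N k))\<^sup>2) * (2 * z / ((of_real (t_node N k))\<^sup>2 - z\<^sup>2)) / of_real A)"
  have z2: "Re (z\<^sup>2) = 0" by (simp add: z_def power2_eq_square)
  obtain T where T: "(\<lambda>n. (-1) ^ Suc n * alias_term A z (Suc n)) sums T"
    and lim0: "(\<lambda>M. \<Sum>k=1..M. exp (z\<^sup>2 - (of_real ((real k - 1/2) * pi / A))\<^sup>2)
             * (2 * z / ((of_real ((real k - 1/2) * pi / A))\<^sup>2 - z\<^sup>2)) / of_real A)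
        \<longlonglongrightarrow> tan (of_real A * z) - (1 + \<i>) * Complex (fresnel_C x) (fresnel_S x) - \<i> / sqrt pi * exp (z\<^sup>2) * T"
    by (rule fresnel_midpoint_limit[OF A x, folded z_def])
  have lim: "(\<lambda>M. \<Sum>k=1..M. g k) \<longlonglongrightarrow> tan (of_real A * z) - (1 + \<i>) * W - \<i> / sqrt pi * exp (z\<^sup>2) * T"
    using lim0 unfolding g_def W_def t_node_eq A_def[symmetric] .
  have Zeq: "(1 + \<i>) * Z = tan (of_real A * z) - (\<Sum>k=1..N. g k)"
    unfolding Z_def g_def A_def z_def by (rule approx_closed_form[OF x])
  have "(\<lambda>M. (\<Sum>k=1..M. g k) - (\<Sum>k=1..N. g k)) \<longlonglongrightarrow> (tan (of_real A * z) - (1 + \<i>) * W - \<i> / sqrt pi * exp (z\<^sup>2) * T) - (\<Sum>k=1..N. g k)"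
    by (intro tendsto_diff lim tendsto_const)
  also have "(tan (of_real A * z) - (1 + \<i>) * W - \<i> / sqrt pi * exp (z\<^sup>2) * T) - (\<Sum>k=1..N. g k)
      = (1 + \<i>) * (Z - W) - \<i> / sqrt pi * exp (z\<^sup>2) * T"
    using Zeq by (simp add: algebra_simps)
  finally have lim2: "(\<lambda>M. (\<Sum>k=1..M. g k) - (\<Sum>k=1..N. g k)) \<longlonglongrightarrow> (1 + \<i>) * (Z - W) - \<i> / sqrt pi * exp (z\<^sup>2) * T" .
  define B where "B = q / A * exp (- (A\<^sup>2)) * ((2 * pi + 1) / (2 * pi))"
  have "norm ((1 + \<i>) * (Z - W) - \<i> / sqrt pi * exp (z\<^sup>2) * T) \<le> B"
  proof (rule Lim_norm_ubound[OF _ lim2])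
    show "\<forall>\<^sub>F M in sequentially. norm ((\<Sum>k=1..M. g k) - (\<Sum>k=1..N. g k)) \<le> B"
      using eventually_ge_at_top[of N]
    proof eventually_elim
      case (elim M)
      have "{1..M} = {1..N} \<union> {Suc N..M}" "{1..N} \<inter> {Suc N..M} = {}" using elim by auto
      hence "(\<Sum>k=1..M. g k) - (\<Sum>k=1..N. g k) = (\<Sum>k=Suc N..M. g k)"
        by (simp add: sum.union_disjoint)
      also have "norm \<dots> \<le> (\<Sum>k=Suc N..M. q / A * exp (- ((t_node N k)\<^sup>2)))"
      proof (rule sum_norm_le)
        fix k assume k: "k \<in> {Suc N..M}"
        have "norm (g k) = exp (- ((t_node N k)\<^sup>2)) * norm (2 * z / ((of_real (t_node N k))\<^sup>2 - z\<^sup>2)) / A"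
          unfolding g_def norm_divide[of "_ * _" "of_real A"] norm_mult[of "exp _"] norm_exp_eq_Re
          using A by (simp add: z2)
        also have "\<dots> \<le> exp (- ((t_node N k)\<^sup>2)) * q / A"
          using A node[of k] k by (intro divide_right_mono mult_left_mono) auto
        finally show "norm (g k) \<le> q / A * exp (- ((t_node N k)\<^sup>2))" by (simp add: mult.commute)
      qed
      also have "\<dots> = q / A * (\<Sum>k=Suc N..M. exp (- ((t_node N k)\<^sup>2)))" by (simp add: sum_distrib_left)
      also have "\<dots> \<le> q / A * (exp (- (A\<^sup>2)) * ((2 * pi + 1) / (2 * pi)))"
        unfolding A_def using q A by (intro mult_left_mono node_tail_bound) (auto simp: A_def)
      finally show ?case by (simp add: B_def)
    qed
  qed simp
  hence "norm ((1 + \<i>) * (Z - W)) \<le> norm (\<i> / sqrt pi * exp (z\<^sup>2) * T) + B"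
    using norm_triangle_ineq2[of "(1 + \<i>) * (Z - W)" "\<i> / sqrt pi * exp (z\<^sup>2) * T"] by linarith
  also have "norm (\<i> / sqrt pi * exp (z\<^sup>2) * T) = norm T / sqrt pi"
    by (simp add: norm_mult norm_divide norm_exp_eq_Re z2)
  also have "norm T / sqrt pi \<le> (c * exp (- (A\<^sup>2)) / (1 - exp (- 2 * A\<^sup>2))) / sqrt pi"
    by (intro divide_right_mono alias_series_bound[OF T A c] aliasing[folded A_def]) auto
  also have "norm ((1 + \<i>) * (Z - W)) = sqrt 2 * norm (W - Z)"
    by (simp add: norm_mult norm_minus_commute cmod_def[of "1 + \<i>"])
  finally show ?thesis by (simp add: A_def B_def W_def Z_def mult_ac)
qed

lemma error_scale:
  "exp (- pi * real N) = exp (pi / 2) * exp (- ((A_rt N)\<^sup>2))"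
  "2 * real N + 1 = 2 * (A_rt N)\<^sup>2 / pi"
  "sqrt (2 * real N + 1) = sqrt 2 * A_rt N / sqrt pi"
proof -
  show "exp (- pi * real N) = exp (pi / 2) * exp (- ((A_rt N)\<^sup>2))"
    unfolding A_rt_sq exp_add[symmetric] by (simp add: algebra_simps)
  show 1: "2 * real N + 1 = 2 * (A_rt N)\<^sup>2 / pi"
    unfolding A_rt_sq by simp
  show "sqrt (2 * real N + 1) = sqrt 2 * A_rt N / sqrt pi"
    unfolding 1 using A_rt_pos[of N] by (simp add: real_sqrt_divide real_sqrt_mult)
qed

text \<open>The difference is \<open>t\<^sup>2 - 2 \<i> b\<^sup>2\<close>; the first bound is the arithmetic-geometric mean inequality
  for \<open>t\<^sup>4 + 4 b\<^sup>4\<close>.\<close>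

lemma norm_node_denominator:
  fixes t b :: real
  assumes "t > 0" "b > 0"
  shows "2 * t * b \<le> norm ((of_real t)\<^sup>2 - ((1 + \<i>) * of_real b)\<^sup>2)"
    and "t\<^sup>2 \<le> norm ((of_real t)\<^sup>2 - ((1 + \<i>) * of_real b)\<^sup>2)"
proof -
  have eq: "(of_real t)\<^sup>2 - ((1 + \<i>) * of_real b)\<^sup>2 = Complex (t\<^sup>2) (- (2 * b\<^sup>2))"
    by (simp add: complex_eq_iff power2_eq_square)
  show "t\<^sup>2 \<le> norm ((of_real t)\<^sup>2 - ((1 + \<i>) * of_real b)\<^sup>2)"
    unfolding eq using complex_Re_le_cmod[of "Complex (t\<^sup>2) (- (2 * b\<^sup>2))"] by simp
  have "(2 * t * b)\<^sup>2 \<le> (norm (Complex (t\<^sup>2) (- (2 * b\<^sup>2))))\<^sup>2"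
    using zero_le_power2[of "t\<^sup>2 - 2 * b\<^sup>2"]
    unfolding cmod_power2 by (simp add: power2_eq_square algebra_simps)
  thus "2 * t * b \<le> norm ((of_real t)\<^sup>2 - ((1 + \<i>) * of_real b)\<^sup>2)"
    unfolding eq by (rule power2_le_imp_le) simp
qed

text \<open>The aliasing terms contribute \<open>(2 + sqrt 2) / sqrt \<pi>\<close> where the first summand of \<open>c_bd\<close>
  allows \<open>40 / (9 sqrt \<pi>)\<close>; the discarded nodes contribute exactly the second summand.\<close>

lemma uniform_error:
  fixes x :: real
  assumes x: "x > 0"
  shows "norm (Complex (fresnel_C x) (fresnel_S x) - Complex (C_approx N x) (S_approx N x))
     \<le> 2 * c_bd N * (exp (- pi * real N) / sqrt (2 * real N + 1))"
proof -
  define A where "A = A_rt N"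
  define b where "b = sqrt pi * x / 2"
  define E where "E = exp (- (A\<^sup>2))"
  define Q where "Q = 1 - exp (- 2 * A\<^sup>2)"
  define X where "X = norm (Complex (fresnel_C x) (fresnel_S x) - Complex (C_approx N x) (S_approx N x))"
  \<comment> \<open>With the roots named, the comparison with \<open>c_bd\<close> is an identity of rational functions.\<close>
  define s where "s = sqrt pi"
  define w where "w = sqrt (2::real)"
  define P where "P = exp (pi / 2)"
  have s: "s > 0" "pi = s * s" by (simp_all add: s_def)
  have w: "w > 0" "w * w = 2" by (simp_all add: w_def)
  have A: "A > 0" by (simp add: A_def A_rt_pos)
  have b: "b > 0" using x by (simp add: b_def)
  have EQ: "E > 0" "Q > 0" "P > 0" using one_minus_exp_pos[of N] by (simp_all add: E_def Q_def P_def A_def)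
  have "sqrt 2 * X \<le> ((2 * sqrt 2 + 2) / A) / sqrt pi * E / Q + (sqrt 2 / A) / A * E * ((2 * pi + 1) / (2 * pi))"
    unfolding X_def E_def Q_def A_def
  proof (rule approximation_error[OF x], fold b_def A_def)
    show "norm (alias_term A ((1 + \<i>) * complex_of_real b) n) \<le> (2 * sqrt 2 + 2) / A * exp (- (real n * A)\<^sup>2)" if "1 \<le> n" for n
      by (rule alias_term_bound[OF A b that])
    show "norm (2 * ((1 + \<i>) * complex_of_real b) / ((complex_of_real (t_node N k))\<^sup>2 - ((1 + \<i>) * complex_of_real b)\<^sup>2)) \<le> sqrt 2 / A"
      if k: "N < k" for k
    proof -
      have t: "A \<le> t_node N k" unfolding A_def by (rule A_rt_le_t_node[OF k])
      hence t0: "t_node N k > 0" using A by linarith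
      have "norm (2 * ((1 + \<i>) * complex_of_real b) / ((complex_of_real (t_node N k))\<^sup>2 - ((1 + \<i>) * complex_of_real b)\<^sup>2))
          = 2 * sqrt 2 * b / norm ((complex_of_real (t_node N k))\<^sup>2 - ((1 + \<i>) * complex_of_real b)\<^sup>2)"
        using b by (simp add: norm_divide norm_mult cmod_def[of "1 + \<i>"])
      also have "\<dots> \<le> 2 * sqrt 2 * b / (2 * t_node N k * b)"
      proof (rule divide_left_mono)
        have p: "0 < 2 * t_node N k * b" using t0 b by simp
        show le: "2 * t_node N k * b \<le> norm ((complex_of_real (t_node N k))\<^sup>2 - ((1 + \<i>) * complex_of_real b)\<^sup>2)"
          by (rule norm_node_denominator(1)[OF t0 b])
        show "0 < norm ((complex_of_real (t_node N k))\<^sup>2 - ((1 + \<i>) * complex_of_real b)\<^sup>2) * (2 * t_node N k * b)"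
          by (rule mult_pos_pos[OF less_le_trans[OF p le] p])
      qed (use b in simp)
      also have "\<dots> = sqrt 2 / t_node N k" using b by simp
      also have "\<dots> \<le> sqrt 2 / A" using t A t0 by (intro divide_left_mono mult_pos_pos) auto
      finally show ?thesis .
    qed
  qed (use A in auto)
  also have "((2 * sqrt 2 + 2) / A) / sqrt pi * E / Q + (sqrt 2 / A) / A * E * ((2 * pi + 1) / (2 * pi))
      = w * ((2 + w) / s * (E / (A * Q)) + E / (A * A) * ((2 * (s * s) + 1) / (2 * (s * s))))"
  proof -
    have w2: "2 * w + 2 = w * (2 + w)" using w by (simp add: algebra_simps)
    have 1: "w * L / A / s * E / Q = w * (L / s * (E / (A * Q)))" for L by (simp add: mult_ac)
    have 2: "w / A / A * E * K = w * (E / (A * A) * K)" for K by simp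
    show ?thesis
      unfolding s_def[symmetric] w_def[symmetric] unfolding s(2) w2 1 2 by (simp only: distrib_left)
  qed
  finally have "X \<le> (2 + w) / s * (E / (A * Q)) + E / (A * A) * ((2 * (s * s) + 1) / (2 * (s * s)))"
    unfolding w_def[symmetric] using w(1) by (simp only: mult_le_cancel_left_pos)
  also have "(2 + w) / s * (E / (A * Q)) \<le> 40 / (9 * s) * (E / (A * Q))"
  proof (rule mult_right_mono)
    have "w \<le> 1.5" unfolding w_def by (intro real_le_lsqrt) (auto simp: power2_eq_square)
    thus "(2 + w) / s \<le> 40 / (9 * s)" using s by (simp add: field_simps)
  qed (use EQ A in simp)
  finally have "X \<le> 40 / (9 * s) * (E / (A * Q)) + E / (A * A) * ((2 * (s * s) + 1) / (2 * (s * s)))"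
    by simp
  also have "\<dots> = 2 * (20 * w / P / (9 * (s * s) * Q) + (2 * (s * s) + 1) / P / (2 * w * (s * s * s) * A)) * (P * E / (w * A / s))"
  proof -
    have "2 * (20 * w / P / (9 * (s * s) * Q)) * (P * E / (w * A / s)) = 40 / (9 * s) * (E / (A * Q))"
      using s(1) w(1) EQ A by (simp add: field_simps)
    moreover have "2 * ((2 * (s * s) + 1) / P / (2 * w * (s * s * s) * A)) * (P * E / (w * A / s))
        = E / (A * A) * ((2 * (s * s) + 1) / ((w * w) * (s * s)))"
    proof -
      have "2 * (K / P / (2 * w * (s * s * s) * A)) * (P * E / (w * A / s)) = E / (A * A) * (K / ((w * w) * (s * s)))" for K
        using s(1) w(1) EQ A by (simp add: field_simps)
      thus ?thesis .
    qed
    ultimately show ?thesis unfolding w(2) by (simp only: distrib_left distrib_right)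
  qed
  also have "\<dots> \<le> 2 * c_bd N * (exp (- pi * real N) / sqrt (2 * real N + 1))"
  proof -
    have c: "c_bd N = 20 * w / P / (9 * (s * s) * Q) * (1 + 2 * s * exp (- beta_val * A\<^sup>2)) + (2 * (s * s) + 1) / P / (2 * w * (s * s * s) * A)"
      unfolding c_bd_def pi_powr_three_halves
      by (simp add: P_def Q_def A_def w_def exp_minus inverse_eq_divide s_def)
    have "20 * w / P / (9 * (s * s) * Q) * 1 \<le> 20 * w / P / (9 * (s * s) * Q) * (1 + 2 * s * exp (- beta_val * A\<^sup>2))"
      using s(1) w(1) EQ by (intro mult_left_mono) auto
    hence "20 * w / P / (9 * (s * s) * Q) + (2 * (s * s) + 1) / P / (2 * w * (s * s * s) * A) \<le> c_bd N"
      unfolding c by simp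
    moreover have "exp (- pi * real N) / sqrt (2 * real N + 1) = P * E / (w * A / s)"
      unfolding error_scale(1,3) by (simp add: P_def E_def A_def w_def s_def)
    moreover have "0 \<le> P * E / (w * A / s)" using s(1) w(1) EQ A by simp
    ultimately show ?thesis by (simp only: mult_left_mono mult_right_mono)
  qed
  finally show ?thesis by (simp add: X_def)
qed

text \<open>The condition on \<open>x\<close> says \<open>b \<le> A / 2\<close>, and then the two error bounds are exactly the two
  summands of \<open>c_tilde_bd\<close>.\<close>

lemma small_argument_error:
  fixes x :: real
  assumes x: "x > 0" "x \<le> sqrt (real N + 1/2)"
  shows "norm (Complex (fresnel_C x) (fresnel_S x) - Complex (C_approx N x) (S_approx N x))
     \<le> sqrt pi * c_tilde_bd N * x * (exp (- pi * real N) / (2 * real N + 1))"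
proof -
  define A where "A = A_rt N"
  define b where "b = sqrt pi * x / 2"
  define E where "E = exp (- (A\<^sup>2))"
  define Q where "Q = 1 - exp (- 2 * A\<^sup>2)"
  define X where "X = norm (Complex (fresnel_C x) (fresnel_S x) - Complex (C_approx N x) (S_approx N x))"
  define s where "s = sqrt pi"
  define w where "w = sqrt (2::real)"
  define P where "P = exp (pi / 2)"
  have s: "s > 0" "pi = s * s" by (simp_all add: s_def)
  have w: "w > 0" by (simp add: w_def)
  have A: "A > 0" by (simp add: A_def A_rt_pos)
  have b: "b > 0" using x by (simp add: b_def)
  have "sqrt pi * x \<le> sqrt pi * sqrt (real N + 1/2)" using x by (intro mult_left_mono) auto
  also have "\<dots> = A" by (simp add: A_def A_rt_def real_sqrt_mult mult.commute)
  finally have bA: "b \<le> A / 2" by (simp add: b_def)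
  have xb: "x = 2 * b / s" using s(1) by (simp add: b_def s_def)
  have EQ: "E > 0" "Q > 0" "P > 0" using one_minus_exp_pos[of N] by (simp_all add: E_def Q_def P_def A_def)
  have "sqrt 2 * X \<le> (8 * sqrt 2 * b / (3 * A\<^sup>2)) / sqrt pi * E / Q + (2 * sqrt 2 * b / A\<^sup>2) / A * E * ((2 * pi + 1) / (2 * pi))"
    unfolding X_def E_def Q_def A_def
  proof (rule approximation_error[OF x(1)], fold b_def A_def)
    show "norm (alias_term A ((1 + \<i>) * complex_of_real b) n) \<le> 8 * sqrt 2 * b / (3 * A\<^sup>2) * exp (- (real n * A)\<^sup>2)" if "1 \<le> n" for n
      by (rule alias_term_bound_small[OF A b bA that])
    show "norm (2 * ((1 + \<i>) * complex_of_real b) / ((complex_of_real (t_node N k))\<^sup>2 - ((1 + \<i>) * complex_of_real b)\<^sup>2)) \<le> 2 * sqrt 2 * b / A\<^sup>2"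
      if k: "N < k" for k
    proof -
      have t: "A \<le> t_node N k" unfolding A_def by (rule A_rt_le_t_node[OF k])
      hence t0: "t_node N k > 0" using A by linarith
      have "A\<^sup>2 \<le> (t_node N k)\<^sup>2" using t A by (intro power_mono) auto
      also note norm_node_denominator(2)[OF t0 b]
      finally have l: "A\<^sup>2 \<le> norm ((complex_of_real (t_node N k))\<^sup>2 - ((1 + \<i>) * complex_of_real b)\<^sup>2)" .
      have "norm (2 * ((1 + \<i>) * complex_of_real b) / ((complex_of_real (t_node N k))\<^sup>2 - ((1 + \<i>) * complex_of_real b)\<^sup>2))
          = 2 * sqrt 2 * b / norm ((complex_of_real (t_node N k))\<^sup>2 - ((1 + \<i>) * complex_of_real b)\<^sup>2)"
        using b by (simp add: norm_divide norm_mult cmod_def[of "1 + \<i>"])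
      also have "\<dots> \<le> 2 * sqrt 2 * b / A\<^sup>2"
        using l A b by (intro divide_left_mono mult_pos_pos) (auto intro: less_le_trans[of _ "A\<^sup>2"])
      finally show ?thesis .
    qed
  qed (use A b in auto)
  also have "(8 * sqrt 2 * b / (3 * A\<^sup>2)) / sqrt pi * E / Q + (2 * sqrt 2 * b / A\<^sup>2) / A * E * ((2 * pi + 1) / (2 * pi))
      = w * (s * (8 / (3 * (s * s * s) * P * Q) + (2 * (s * s) + 1) / ((s * s)\<^sup>2 * P * A)) * (2 * b / s) * (P * E / (2 * A\<^sup>2 / (s * s))))"
  proof -
    have 1: "(8 * w * b / (3 * A\<^sup>2)) / s * E / Q = w * (s * (8 / (3 * (s * s * s) * P * Q)) * (2 * b / s) * (P * E / (2 * A\<^sup>2 / (s * s))))"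
      using s(1) w EQ A by (simp add: field_simps power2_eq_square)
    have 2: "(2 * w * b / A\<^sup>2) / A * E * (K / (2 * (s * s))) = w * (s * (K / ((s * s)\<^sup>2 * P * A)) * (2 * b / s) * (P * E / (2 * A\<^sup>2 / (s * s))))" for K
      using s(1) w EQ A by (simp add: field_simps power2_eq_square)
    show ?thesis
      unfolding s_def[symmetric] w_def[symmetric] unfolding s(2) 1 2 by (simp only: distrib_left distrib_right)
  qed
  finally have "X \<le> s * (8 / (3 * (s * s * s) * P * Q) + (2 * (s * s) + 1) / ((s * s)\<^sup>2 * P * A)) * (2 * b / s) * (P * E / (2 * A\<^sup>2 / (s * s)))"
    unfolding w_def[symmetric] using w by (simp only: mult_le_cancel_left_pos)
  also have "8 / (3 * (s * s * s) * P * Q) + (2 * (s * s) + 1) / ((s * s)\<^sup>2 * P * A) = c_tilde_bd N"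
    unfolding c_tilde_bd_def pi_powr_three_halves
    by (simp add: P_def Q_def A_def s_def)
  also have "P * E / (2 * A\<^sup>2 / (s * s)) = exp (- pi * real N) / (2 * real N + 1)"
    unfolding error_scale(1,2) by (simp add: P_def E_def A_def s_def)
  finally show ?thesis unfolding xb[symmetric] unfolding X_def s_def .
qed

lemma fresnel_odd: "fresnel_C (- x) = - fresnel_C x" "fresnel_S (- x) = - fresnel_S x"
proof -
  have "(LBINT t=0..- x. f t) = - (LBINT t=0..x. f t)" if "\<And>t. f (- t) = f t" for f :: "real \<Rightarrow> real"
  proof -
    have "(LBINT t=0..- x. f t) = (LBINT t=- ereal (- x)..- 0. f (- t))"
      by (rule interval_integral_reflect)
    also have "\<dots> = (LBINT t=x..0. f t)" by (simp add: that)
    also have "\<dots> = - (LBINT t=0..x. f t)" by (rule interval_integral_endpoints_reverse)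
    finally show ?thesis .
  qed
  thus "fresnel_C (- x) = - fresnel_C x" "fresnel_S (- x) = - fresnel_S x"
    unfolding fresnel_C_def fresnel_S_def by simp_all
qed

lemma approx_odd: "C_approx N (- x) = - C_approx N x" "S_approx N (- x) = - S_approx N x"
  by (simp_all add: C_approx_def S_approx_def add_divide_distrib diff_divide_distrib)

lemma approx_error_bounds:
  fixes K :: real
  assumes pos: "\<And>y. y > 0 \<Longrightarrow> y = \<bar>x\<bar> \<Longrightarrow> norm (Complex (fresnel_C y) (fresnel_S y) - Complex (C_approx N y) (S_approx N y)) \<le> K"
    and K: "K \<ge> 0"
  shows "\<bar>fresnel_C x - C_approx N x\<bar> \<le> K \<and> \<bar>fresnel_S x - S_approx N x\<bar> \<le> K"
proof (cases "x = 0")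
  case True
  thus ?thesis using K
    by (simp add: fresnel_C_def fresnel_S_def C_approx_def S_approx_def zero_ereal_def[symmetric])
next
  case False
  have abs_eq: "\<bar>fresnel_C x - C_approx N x\<bar> = \<bar>fresnel_C \<bar>x\<bar> - C_approx N \<bar>x\<bar>\<bar>"
       "\<bar>fresnel_S x - S_approx N x\<bar> = \<bar>fresnel_S \<bar>x\<bar> - S_approx N \<bar>x\<bar>\<bar>"
    by (cases "x \<ge> 0"; simp add: fresnel_odd approx_odd)+
  define d where "d = Complex (fresnel_C \<bar>x\<bar>) (fresnel_S \<bar>x\<bar>) - Complex (C_approx N \<bar>x\<bar>) (S_approx N \<bar>x\<bar>)"
  have "norm d \<le> K" unfolding d_def using False by (intro pos) auto
  thus ?thesis unfolding abs_eq using abs_Re_le_cmod[of d] abs_Im_le_cmod[of d] by (simp add: d_def)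
qed

theorem mainTheorem6:
  shows "(\<forall>N\<ge>1. \<forall>x::real.
            \<bar>fresnel_C x - C_approx N x\<bar> \<le> 2 * c_bd N * (exp (- pi * real N) / sqrt (2 * real N + 1)) \<and>
            \<bar>fresnel_S x - S_approx N x\<bar> \<le> 2 * c_bd N * (exp (- pi * real N) / sqrt (2 * real N + 1)))
       \<and> (\<forall>N\<ge>1. \<forall>x::real. \<bar>x\<bar> \<le> sqrt (real N + 1/2) \<longrightarrow>
            \<bar>fresnel_C x - C_approx N x\<bar>
              \<le> sqrt pi * c_tilde_bd N * \<bar>x\<bar> * (exp (- pi * real N) / (2 * real N + 1)) \<and>
            \<bar>fresnel_S x - S_approx N x\<bar>
              \<le> sqrt pi * c_tilde_bd N * \<bar>x\<bar> * (exp (- pi * real N) / (2 * real N + 1)))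
       \<and> strict_antimono_on {1..} c_bd \<and> strict_antimono_on {1..} c_tilde_bd
       \<and> (\<forall>N\<ge>1. 0 < c_bd N \<and> c_bd N < 0.83)
       \<and> (\<forall>N\<ge>1. 0 < c_tilde_bd N \<and> c_tilde_bd N < 0.18)"
proof (intro conjI allI impI)
  fix N :: nat and x :: real
  have "\<bar>fresnel_C x - C_approx N x\<bar> \<le> 2 * c_bd N * (exp (- pi * real N) / sqrt (2 * real N + 1)) \<and>
        \<bar>fresnel_S x - S_approx N x\<bar> \<le> 2 * c_bd N * (exp (- pi * real N) / sqrt (2 * real N + 1))"
    using c_bd_pos[of N] by (intro approx_error_bounds uniform_error) auto
  thus "\<bar>fresnel_C x - C_approx N x\<bar> \<le> 2 * c_bd N * (exp (- pi * real N) / sqrt (2 * real N + 1))"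
       "\<bar>fresnel_S x - S_approx N x\<bar> \<le> 2 * c_bd N * (exp (- pi * real N) / sqrt (2 * real N + 1))" by auto
  assume x: "\<bar>x\<bar> \<le> sqrt (real N + 1/2)"
  have "\<bar>fresnel_C x - C_approx N x\<bar> \<le> sqrt pi * c_tilde_bd N * \<bar>x\<bar> * (exp (- pi * real N) / (2 * real N + 1)) \<and>
        \<bar>fresnel_S x - S_approx N x\<bar> \<le> sqrt pi * c_tilde_bd N * \<bar>x\<bar> * (exp (- pi * real N) / (2 * real N + 1))"
  proof (rule approx_error_bounds)
    fix y assume "y > 0" "y = \<bar>x\<bar>"
    thus "norm (Complex (fresnel_C y) (fresnel_S y) - Complex (C_approx N y) (S_approx N y)) \<le> sqrt pi * c_tilde_bd N * \<bar>x\<bar> * (exp (- pi * real N) / (2 * real N + 1))"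
      using small_argument_error[of y N] x by simp
  qed (use c_tilde_bd_pos[of N] in simp)
  thus "\<bar>fresnel_C x - C_approx N x\<bar> \<le> sqrt pi * c_tilde_bd N * \<bar>x\<bar> * (exp (- pi * real N) / (2 * real N + 1))"
       "\<bar>fresnel_S x - S_approx N x\<bar> \<le> sqrt pi * c_tilde_bd N * \<bar>x\<bar> * (exp (- pi * real N) / (2 * real N + 1))" by auto
next
  show "strict_antimono_on {1..} c_bd"
    by (auto intro!: monotone_onI c_bd_strict_antimono)
  show "strict_antimono_on {1..} c_tilde_bd"
    by (auto intro!: monotone_onI c_tilde_bd_strict_antimono)
next
  fix N :: nat assume N: "1 \<le> N"
  show "0 < c_bd N" "0 < c_tilde_bd N" by (rule c_bd_pos c_tilde_bd_pos)+
  show "c_bd N < 0.83"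
    using N c_bd_one c_bd_strict_antimono[of 1 N] by (cases "N = 1") (auto intro: less_trans)
  show "c_tilde_bd N < 0.18"
    using N c_tilde_bd_one c_tilde_bd_strict_antimono[of 1 N] by (cases "N = 1") (auto intro: less_trans)
qed

end
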